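(* Let $\mathcal{R}^{(3)}:SU(2)\to SU(3)$ be the composition of the two-to-one surjection $SU(2)\to SO(3)$ with the inclusion $SO(3)\subset SU(3)$ as real matrices, and let $\mathcal{R}^{(4)}:SU(2)\to Sp(4)$ be the irreducible $4$-dimensional representation of $SU(2)$. Let $SU(2)$ act on $SU(3)$ by $g\cdot\mathbf{B}=\mathcal{R}^{(3)}(g)\,\mathbf{B}\,\mathcal{R}^{(3)}(g)^{-1}$ and on $Sp(4)$ by $g\cdot\mathbf{B}=\mathcal{R}^{(4)}(g)\,\mathbf{B}\,\mathcal{R}^{(4)}(g)^{-1}$. Then: (i) the largest finite stabiliser in $SU(2)$ of a point of $SU(3)$ is (isomorphic to) the quaternionic group $Q_4$ of order $8$; (ii) the largest finite stabiliser in $SU(2)$ of a point of $Sp(4)$ is (isomorphic to) the binary tetrahedral group $BA_4$ of order $24$.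
   Context: $Sp(4)$ denotes the compact symplectic group of all unitary $4\times4$ complex matrices $\mathbf{B}$ with $\mathbf{B}^tJ\mathbf{B}=J$, where $J=\begin{pmatrix}0&I_2\\-I_2&0\end{pmatrix}$ and $I_2$ is the $2\times 2$ identity; the irreducible $4$-dimensional representation of $SU(2)$ is symplectic, so (in a suitable basis) its image lies in $Sp(4)$. Stabilisers are taken in $SU(2)$, i.e. the stabiliser of $\mathbf{B}$ is $\{g\in SU(2): g\cdot \mathbf{B}=\mathbf{B}\}$. "Largest" means of largest order among the finite stabilisers which occur. The quaternionic group $Q_4=\{\pm1,\pm i,\pm j,\pm k\}$ is the preimage in $SU(2)$ of the Klein four-group $C_2\times C_2\subset SO(3)$; the binary tetrahedral group $BA_4$ is the preimage in $SU(2)$ of the rotation group $A_4\subset SO(3)$ of the tetrahedron. *)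

theory Defs
  imports "HOL-Analysis.Analysis" "HOL-Algebra.Group_Action"
begin

definition conj_transpose :: "complex^'n^'m \<Rightarrow> complex^'m^'n" (\<open>_\<^sup>\<dagger>\<close> [1000] 999)
  where "A\<^sup>\<dagger> = map_matrix cnj (transpose A)"

definition unitary_matrix :: "complex^'n^'n \<Rightarrow> bool"
  where "unitary_matrix A \<longleftrightarrow> A\<^sup>\<dagger> ** A = mat 1 \<and> A ** A\<^sup>\<dagger> = mat 1"

definition SU :: "(complex^'n^'n) monoid"
  where "SU = \<lparr>carrier = {A. unitary_matrix A \<and> det A = 1}, mult = (**), one = mat 1\<rparr>"

abbreviation SU2 :: "(complex^2^2) monoid" where "SU2 \<equiv> SU"

abbreviation SU3 :: "(complex^3^3) monoid" where "SU3 \<equiv> SU"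

definition symplectic_J :: "complex^4^4"
  where "symplectic_J = (\<chi> i j. if (i, j) \<in> {(1, 3), (2, 4)} then 1
                               else if (i, j) \<in> {(3, 1), (4, 2)} then -1 else 0)"

definition Sp4 :: "(complex^4^4) monoid"
  where "Sp4 = \<lparr>carrier = {B. unitary_matrix B \<and> transpose B ** symplectic_J ** B = symplectic_J},
                mult = (**), one = mat 1\<rparr>"


definition pauli :: "complex^2^2^3"
  where "pauli = vector [vector [vector [0, 1], vector [1, 0]],
                         vector [vector [0, -\<i>], vector [\<i>, 0]],
                         vector [vector [1, 0], vector [0, -1]]]"

text \<open>The two-to-one surjection of \<open>SU(2)\<close> onto \<open>SO(3)\<close>: the matrix, in the basis of Pauli
  matrices, of \<open>X \<mapsto> g X g\<^sup>\<dagger>\<close> on the traceless Hermitian \<open>2 \<times> 2\<close> matrices.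
  The trace below is real.\<close>

definition cover :: "complex^2^2 \<Rightarrow> real^3^3"
  where "cover g = (\<chi> i j. Re (trace (pauli $ i ** (g ** pauli $ j ** g\<^sup>\<dagger>))) / 2)"

definition R3 :: "complex^2^2 \<Rightarrow> complex^3^3"
  where "R3 g = map_matrix of_real (cover g)"

text \<open>The irreducible four-dimensional representation is the third symmetric power of \<open>\<complex>\<^sup>2\<close>.
  \<open>cube v\<close> is the coordinate vector of \<open>v \<otimes> v \<otimes> v\<close>
  in an orthonormal basis of \<open>Sym\<^sup>3 \<complex>\<^sup>2\<close>, ordered and signed so that the invariant symplectic
  form has matrix \<open>symplectic_J\<close>; these vectors span, so \<open>R4 g\<close> is determined by its values
  on them.\<close>

definition cube :: "complex^2 \<Rightarrow> complex^4"
  where "cube v = (\<chi> k. if k = 1 then (v$1)^3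
                       else if k = 2 then of_real (sqrt 3) * (v$1)^2 * v$2
                       else if k = 3 then (v$2)^3
                       else - of_real (sqrt 3) * v$1 * (v$2)^2)"

definition R4 :: "complex^2^2 \<Rightarrow> complex^4^4"
  where "R4 g = (THE M. \<forall>v. M *v cube v = cube (g *v v))"


lemma SU2_iff:
  "g \<in> carrier SU2 \<longleftrightarrow>
    g$1$2 = - cnj (g$2$1) \<and> g$2$2 = cnj (g$1$1) \<and> (cmod (g$1$1))^2 + (cmod (g$2$1))^2 = 1"
  (is "?L \<longleftrightarrow> ?R")
proof
  assume ?L
  then have u: "g\<^sup>\<dagger> ** g = mat 1" and d: "det g = 1"
    by (auto simp: SU_def unitary_matrix_def)
  let ?a = "g$1$1" and ?b = "g$1$2" and ?c = "g$2$1" and ?d = "g$2$2"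
  have e: "cnj ?a * ?a + cnj ?c * ?c = 1" "cnj ?a * ?b + cnj ?c * ?d = 0"
    using u by (auto simp: vec_eq_iff forall_2 matrix_matrix_mult_def conj_transpose_def sum_2
        transpose_def mat_def)
  have d: "?a * ?d - ?b * ?c = 1" using d by (simp add: det_2)
  have "cnj ?a * (?a * ?d - ?b * ?c) = (cnj ?a * ?a + cnj ?c * ?c) * ?d - ?c * (cnj ?a * ?b + cnj ?c * ?d)"
    by (simp add: algebra_simps)
  then have 1: "?d = cnj ?a" using e d by simp
  have "cnj ?c * (?a * ?d - ?b * ?c) = ?a * (cnj ?a * ?b + cnj ?c * ?d) - ?b * (cnj ?a * ?a + cnj ?c * ?c)"
    by (simp add: algebra_simps)
  then have 2: "?b = - cnj ?c" using e d by simp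
  have "complex_of_real ((cmod ?a)^2 + (cmod ?c)^2) = 1"
    using e(1) by (simp only: of_real_add complex_norm_square) (simp add: mult.commute)
  then have "(cmod ?a)^2 + (cmod ?c)^2 = 1" using of_real_eq_1_iff by blast
  then show ?R using 1 2 by simp
next
  assume R: ?R
  then have "complex_of_real ((cmod (g$1$1))^2 + (cmod (g$2$1))^2) = 1" by simp
  then have "g$1$1 * cnj (g$1$1) + g$2$1 * cnj (g$2$1) = 1"
    by (simp only: of_real_add complex_norm_square)
  then show ?L using R
    by (auto simp: SU_def unitary_matrix_def det_2 vec_eq_iff forall_2 matrix_matrix_mult_def
        conj_transpose_def sum_2 transpose_def mat_def algebra_simps)
qed

text \<open>\<open>cover\<close> is indeed a two-to-one homomorphism onto \<open>SO(3)\<close>.\<close>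

lemma cover_entries:
  assumes "g$1$2 = - cnj (g$2$1)" "g$2$2 = cnj (g$1$1)"
    "Re (g$1$1) = a" "Im (g$1$1) = b" "Re (g$2$1) = c" "Im (g$2$1) = d"
  shows "cover g = vector [vector [a^2 - b^2 - c^2 + d^2, 2*a*b - 2*c*d, 2*a*c + 2*b*d],
                           vector [- 2*a*b - 2*c*d, a^2 - b^2 + c^2 - d^2, 2*a*d - 2*b*c],
                           vector [2*b*d - 2*a*c, - 2*a*d - 2*b*c, a^2+b^2-c^2-d^2]]"
  using assms
  apply (simp add: vec_eq_iff forall_3 cover_def pauli_def trace_def sum_2 matrix_matrix_mult_def
    conj_transpose_def transpose_def vector_2 vector_3)
  apply (simp add: power2_eq_square algebra_simps)
  done


lemma SU2_mult: "g \<in> carrier SU2 \<Longrightarrow> h \<in> carrier SU2 \<Longrightarrow> g ** h \<in> carrier SU2"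
  unfolding SU_def unitary_matrix_def
  apply (auto simp: det_mul)
   apply (subgoal_tac "(g ** h)\<^sup>\<dagger> = h\<^sup>\<dagger> ** g\<^sup>\<dagger>")
    apply (metis matrix_mul_assoc matrix_mul_lid)
   apply (simp add: conj_transpose_def vec_eq_iff transpose_def matrix_matrix_mult_def mult.commute)
  apply (subgoal_tac "(g ** h)\<^sup>\<dagger> = h\<^sup>\<dagger> ** g\<^sup>\<dagger>")
   apply (metis matrix_mul_assoc matrix_mul_lid)
  apply (simp add: conj_transpose_def vec_eq_iff transpose_def matrix_matrix_mult_def mult.commute)
  done

lemma cover_mult:
  assumes "g \<in> carrier SU2" "h \<in> carrier SU2"
  shows "cover (g ** h) = cover g ** cover h"
proof -
  have e: "g$1$2 = - cnj (g$2$1)" "g$2$2 = cnj (g$1$1)" "h$1$2 = - cnj (h$2$1)" "h$2$2 = cnj (h$1$1)"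
    "(g**h)$1$2 = - cnj ((g**h)$2$1)" "(g**h)$2$2 = cnj ((g**h)$1$1)"
    using assms SU2_mult[OF assms] SU2_iff by auto
  obtain a b c d where 1: "Re (g$1$1) = a" "Im (g$1$1) = b" "Re (g$2$1) = c" "Im (g$2$1) = d" by blast
  obtain a' b' c' d' where 2: "Re (h$1$1) = a'" "Im (h$1$1) = b'" "Re (h$2$1) = c'" "Im (h$2$1) = d'" by blast
  have 3: "Re ((g**h)$1$1) = a*a' - b*b' - c*c' - d*d'" 
    "Im ((g**h)$1$1) = a*b' + b*a' + d*c' - c*d'" 
    "Re ((g**h)$2$1) = c*a' - d*b' + a*c' + b*d'" 
    "Im ((g**h)$2$1) = d*a' + c*b' + a*d' - b*c'" 
    by (simp_all add: matrix_matrix_mult_def sum_2 e(1-4) 1 2 algebra_simps)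
  show ?thesis
    unfolding cover_entries[OF e(1,2) 1] cover_entries[OF e(3,4) 2] cover_entries[OF e(5,6) 3]
    by (simp add: vec_eq_iff forall_3 matrix_matrix_mult_def sum_3 vector_3) (auto simp: power2_eq_square algebra_simps)
qed

lemma cover_rotation:
  assumes "g \<in> carrier SU2"
  shows "rotation_matrix (cover g)"
proof -
  have e: "g$1$2 = - cnj (g$2$1)" "g$2$2 = cnj (g$1$1)" and n: "(cmod (g$1$1))^2 + (cmod (g$2$1))^2 = 1"
    using assms SU2_iff by auto
  obtain a b c d where 1: "Re (g$1$1) = a" "Im (g$1$1) = b" "Re (g$2$1) = c" "Im (g$2$1) = d" by blast
  have n: "a^2 + b^2 + c^2 + d^2 = 1" using n 1 by (simp add: cmod_power2)
  have k: "(a^2+b^2+c^2+d^2)*(a^2+b^2+c^2+d^2) = 1" "(a^2+b^2+c^2+d^2)*((a^2+b^2+c^2+d^2)*(a^2+b^2+c^2+d^2)) = 1" using n by auto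
  have "orthogonal_matrix (cover g)"
    unfolding orthogonal_matrix cover_entries[OF e 1]
    apply (simp add: vec_eq_iff forall_3 matrix_matrix_mult_def sum_3 vector_3 transpose_def mat_def)
    apply (intro conjI)
            apply (insert k(1), (simp add: power2_eq_square algebra_simps; fail)+)
    done
  moreover have "det (cover g) = (a^2+b^2+c^2+d^2)*((a^2+b^2+c^2+d^2)*(a^2+b^2+c^2+d^2))"
    unfolding cover_entries[OF e 1]
    by (simp add: det_3 vector_3) (simp add: power2_eq_square algebra_simps)
  ultimately show ?thesis using k(2) by (simp add: rotation_matrix_def)
qed

lemma cover_fibre:
  assumes "g \<in> carrier SU2" "h \<in> carrier SU2"
  shows "cover g = cover h \<longleftrightarrow> h = g \<or> h = - g"
proof -
  have e: "g$1$2 = - cnj (g$2$1)" "g$2$2 = cnj (g$1$1)" "h$1$2 = - cnj (h$2$1)" "h$2$2 = cnj (h$1$1)" 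
    and n: "(cmod (g$1$1))^2 + (cmod (g$2$1))^2 = 1" "(cmod (h$1$1))^2 + (cmod (h$2$1))^2 = 1"
    using assms SU2_iff by auto
  obtain a b c d where 1: "Re (g$1$1) = a" "Im (g$1$1) = b" "Re (g$2$1) = c" "Im (g$2$1) = d" by blast
  obtain x y z w where 2: "Re (h$1$1) = x" "Im (h$1$1) = y" "Re (h$2$1) = z" "Im (h$2$1) = w" by blast
  have n: "a^2 + b^2 + c^2 + d^2 = 1" "x^2 + y^2 + z^2 + w^2 = 1" using n 1 2 by (simp_all add: cmod_power2)
  have "h = g \<longleftrightarrow> x = a \<and> y = b \<and> z = c \<and> w = d"
    by (auto simp: vec_eq_iff forall_2 e complex_eq_iff 1 2)
  moreover have "h = - g \<longleftrightarrow> x = -a \<and> y = -b \<and> z = -c \<and> w = -d"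
    by (auto simp: vec_eq_iff forall_2 e complex_eq_iff 1 2)
  moreover have "cover g = cover h \<longleftrightarrow> (x = a \<and> y = b \<and> z = c \<and> w = d) \<or> (x = -a \<and> y = -b \<and> z = -c \<and> w = -d)"
  proof
    assume "cover g = cover h"
    then have E: "a^2 - b^2 - c^2 + d^2 = x^2 - y^2 - z^2 + w^2" "2*a*b - 2*c*d = 2*x*y-2*z*w" 
     "2*a*c + 2*b*d = 2*x*z+2*y*w" "- 2*a*b - 2*c*d = - 2*x*y - 2*z*w" 
     "a^2 - b^2 + c^2 - d^2 = x^2 - y^2 + z^2 - w^2" "2*a*d - 2*b*c = 2*x*w-2*y*z"
     "2*b*d - 2*a*c = 2*y*w - 2*x*z" "- 2*a*d - 2*b*c = -2*x*w-2*y*z" "a^2+b^2-c^2-d^2 = x^2+y^2-z^2-w^2"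
      unfolding cover_entries[OF e(1,2) 1] cover_entries[OF e(3,4) 2]
      by (simp_all add: vec_eq_iff forall_3 vector_3)
    have sq: "a*a = x*x" "b*b = y*y" "c*c = z*z" "d*d = w*w"
      using E n by (simp_all add: power2_eq_square)
    have pr: "a*b = x*y" "a*c = x*z" "a*d = x*w" "b*c = y*z" "b*d = y*w" "c*d = z*w"
      using E by simp_all
    have nz: "a \<noteq> 0 \<or> b \<noteq> 0 \<or> c \<noteq> 0 \<or> d \<noteq> 0" using n by auto
    let ?s = "a*x + b*y + c*z + d*w"
    have "a * ?s = (a*a)*x + (a*b)*y + (a*c)*z + (a*d)*w" "b * ?s = (a*b)*x + (b*b)*y + (b*c)*z + (b*d)*w"
       "c * ?s = (a*c)*x + (b*c)*y + (c*c)*z + (c*d)*w" "d * ?s = (a*d)*x + (b*d)*y + (c*d)*z + (d*d)*w"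
      by (simp_all add: algebra_simps)
    then have "a * ?s = x*(x^2+y^2+z^2+w^2)" "b * ?s = y*(x^2+y^2+z^2+w^2)"
       "c * ?s = z*(x^2+y^2+z^2+w^2)" "d * ?s = w*(x^2+y^2+z^2+w^2)"
      unfolding sq pr by (simp_all add: algebra_simps power2_eq_square)
    then have s: "x = a * ?s" "y = b * ?s" "z = c * ?s" "w = d * ?s" using n by simp_all
    obtain r where r: "x = a * r" "y = b * r" "z = c * r" "w = d * r" using s by blast
    have "x^2+y^2+z^2+w^2 = (a^2+b^2+c^2+d^2) * (r * r)"
      unfolding r by (simp add: algebra_simps power2_eq_square)
    then have "r * r = 1" using n by simp
    then have "r = 1 \<or> r = -1" using square_eq_1_iff by blast
    then show "(x = a \<and> y = b \<and> z = c \<and> w = d) \<or> (x = -a \<and> y = -b \<and> z = -c \<and> w = -d)"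
      using r by auto
  next
    assume "(x = a \<and> y = b \<and> z = c \<and> w = d) \<or> (x = -a \<and> y = -b \<and> z = -c \<and> w = -d)"
    then show "cover g = cover h"
      unfolding cover_entries[OF e(1,2) 1] cover_entries[OF e(3,4) 2] by auto
  qed
  ultimately show ?thesis by blast
qed

lemma cover_surj:
  assumes A: "rotation_matrix A"
  shows "\<exists>g \<in> carrier SU2. cover g = A"
proof -
  have oA: "orthogonal_matrix A" "det A = 1" using A by (auto simp: rotation_matrix_def)
  define p q s where "p = A$1$3" and "q = A$2$3" and "s = A$3$3"
  have n: "p^2 + q^2 + s^2 = 1"
    using oA(1) by (simp add: orthogonal_matrix vec_eq_iff forall_3 matrix_matrix_mult_def sum_3
      transpose_def mat_def p_def q_def s_def power2_eq_square)
  obtain g where g: "g \<in> carrier SU2" "cover g $ 1 $ 3 = p" "cover g $ 2 $ 3 = q" "cover g $ 3 $ 3 = s"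
  proof (cases "s = -1")
    case True
    then have pq: "p = 0" "q = 0" using n by (auto simp: sum_power2_eq_zero_iff)
    let ?g = "vector [vector [0, -1], vector [1, 0]] :: complex^2^2"
    have "?g \<in> carrier SU2" by (simp add: SU2_iff)
    moreover have "cover ?g = vector [vector [-1, 0, 0], vector [0, 1, 0], vector [0, 0, -1]]"
      by (subst cover_entries[of _ 0 0 1 0]) simp_all
    ultimately show ?thesis using that[of ?g] pq True by simp
  next
    case False
    have "s^2 \<le> 1" using n by (smt (verit) zero_le_power2)
    then have "\<bar>s\<bar> \<le> 1" by (simp add: abs_square_le_1)
    then have s1: "1 + s > 0" using False by linarith
    define a where "a = sqrt ((1 + s) / 2)"
    have a: "a > 0" "a^2 = (1 + s)/2" using s1 by (auto simp: a_def)
    define x y where "x = p / (2 * a)" and "y = q / (2 * a)"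
    have xy: "2 * a * x = p" "2 * a * y = q" using a by (auto simp: x_def y_def)
    have "(1 + s) * (1 - s) = p^2 + q^2" using n by (simp add: algebra_simps power2_eq_square)
    also have "\<dots> = (2 * a^2) * (2 * (x^2 + y^2))"
      by (simp add: xy[symmetric] algebra_simps power2_eq_square)
    also have "2 * a^2 = 1 + s" using a by simp
    finally have x2: "2 * (x^2 + y^2) = 1 - s" using s1 by simp
    let ?g = "vector [vector [of_real a, - Complex x (- y)], vector [Complex x y, of_real a]] :: complex^2^2"
    have n1: "a^2 + (x^2 + y^2) = 1" using x2 a(2) by simp
    have "?g \<in> carrier SU2" using n1 by (simp add: SU2_iff complex_eq_iff cmod_power2)
    moreover have "cover ?g $ 1 $ 3 = p" "cover ?g $ 2 $ 3 = q" "cover ?g $ 3 $ 3 = s"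
      using a(2) x2 xy by (subst cover_entries[of _ a 0 x y]; simp add: complex_eq_iff vector_3)+
    ultimately show ?thesis using that[of ?g] by simp
  qed
  have rg: "orthogonal_matrix (cover g)" "det (cover g) = 1"
    using cover_rotation[OF g(1)] by (auto simp: rotation_matrix_def)
  define B where "B = transpose (cover g) ** A"
  have B: "orthogonal_matrix B" "det B = 1"
    using oA rg by (auto simp: B_def orthogonal_matrix_mul orthogonal_matrix_transpose det_mul)
  have col: "B $ i $ 3 = (if i = 3 then 1 else 0)" for i
  proof -
    have "B $ i $ 3 = (transpose (cover g) ** cover g) $ i $ 3"
      unfolding B_def by (simp add: matrix_matrix_mult_def sum_3 transpose_def g p_def[symmetric] q_def[symmetric] s_def[symmetric])
    then show ?thesis using rg by (simp add: orthogonal_matrix mat_def)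
  qed
  have b33: "B$3$3 = 1" "B$1$3 = 0" "B$2$3 = 0" by (simp_all add: col)
  have BB: "B ** transpose B = mat 1" using B(1) by (simp add: orthogonal_matrix_def)
  have "(B ** transpose B) $ 3 $ 3 = 1" unfolding BB by (simp add: mat_def)
  then have "B$3$1 ^2 + B$3$2^2 = 0" by (simp add: matrix_matrix_mult_def sum_3 transpose_def b33 power2_eq_square)
  then have b3: "B$3$1 = 0" "B$3$2 = 0" by (auto simp: sum_power2_eq_zero_iff)
  have "transpose B ** B = mat 1" using B(1) by (simp add: orthogonal_matrix)
  then have o: "B$1$1*B$1$1 + B$2$1*B$2$1 = 1" "B$1$1*B$1$2 + B$2$1*B$2$2 = 0"
    by (simp_all add: vec_eq_iff forall_3 matrix_matrix_mult_def sum_3 transpose_def mat_def b3)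
  have d: "B$1$1 * B$2$2 - B$1$2 * B$2$1 = 1" using B(2) by (simp add: det_3 b33 b3)
  define u v where "u = B$1$1" and "v = B$2$1"
  have "B$2$2 = (u * u + v * v) * B$2$2" using o by (simp add: u_def v_def)
  also have "\<dots> = u * (B$1$1 * B$2$2 - B$1$2 * B$2$1) + v * (B$1$1*B$1$2 + B$2$1*B$2$2)"
    by (simp add: u_def v_def algebra_simps)
  finally have b22: "B$2$2 = u" using o d by simp
  have "B$1$2 = (u * u + v * v) * B$1$2" using o by (simp add: u_def v_def)
  also have "\<dots> = u * (B$1$1*B$1$2 + B$2$1*B$2$2) - v * (B$1$1 * B$2$2 - B$1$2 * B$2$1)"
    by (simp add: u_def v_def algebra_simps)
  finally have b12: "B$1$2 = - v" using o d by simp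
  obtain t where t: "u = cos t" "v = sin t"
    using sincos_total_2pi[of u v] o(1) unfolding u_def v_def power2_eq_square by blast
  define k :: "complex^2^2" where "k = vector [vector [cis (-(t/2)), 0], vector [0, cis (t/2)]]"
  have k: "k \<in> carrier SU2" by (simp add: SU2_iff k_def cis_cnj)
  have "cover k = B"
    apply (subst cover_entries[of _ "cos (t/2)" "- sin (t/2)" 0 0])
    using cos_double[of "t/2"] sin_double[of "t/2"] 
    by (simp_all add: k_def cis_cnj vec_eq_iff forall_3 vector_3 b33 b3 b22 b12 u_def[symmetric] v_def[symmetric] t)
  then have "cover (g ** k) = cover g ** (transpose (cover g) ** A)"
    by (simp add: cover_mult g k B_def)
  also have "\<dots> = A" using rg by (metis matrix_mul_assoc matrix_mul_lid orthogonal_matrix_def)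
  finally show ?thesis using SU2_mult[OF g(1) k] by blast
qed

lemma R3_SU3:
  assumes "g \<in> carrier SU2"
  shows "R3 g \<in> carrier SU3"
proof -
  have *: "map_matrix complex_of_real A ** map_matrix of_real B = map_matrix of_real (A ** B)" for A B :: "real^3^3"
    by (simp add: vec_eq_iff matrix_matrix_mult_def)
  have d: "det (map_matrix complex_of_real A) = of_real (det A)" for A :: "real^3^3"
    by (simp add: det_3)
  have "(R3 g)\<^sup>\<dagger> = map_matrix of_real (transpose (cover g))"
    by (simp add: R3_def conj_transpose_def vec_eq_iff transpose_def)
  moreover have "map_matrix complex_of_real (mat 1 :: real^3^3) = mat 1"
    by (simp add: vec_eq_iff mat_def)
  ultimately show ?thesis using cover_rotation[OF assms]
    by (simp add: SU_def unitary_matrix_def R3_def * d rotation_matrix_def orthogonal_matrix_def)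
qed

lemma R3_hom: "R3 \<in> hom SU2 SU3"
proof -
  have m: "mult SU2 = (**)" "mult SU3 = (**)" by (auto simp: SU_def)
  have "R3 (g ** h) = R3 g ** R3 h" if "g \<in> carrier SU2" "h \<in> carrier SU2" for g h
    unfolding R3_def cover_mult[OF that] by (simp add: vec_eq_iff matrix_matrix_mult_def)
  then show ?thesis by (auto simp: hom_def R3_SU3 m)
qed

text \<open>\<open>R4\<close> is indeed an irreducible representation with image in \<open>Sp(4)\<close>.\<close>

definition R4mat :: "complex^2^2 \<Rightarrow> complex^4^4" where
 "R4mat g = (let a = g$1$1; b = g$1$2; c = g$2$1; d = g$2$2; s = complex_of_real (sqrt 3) in
   (\<chi> i j. 
     if i = 1 then (if j = 1 then a^3 else if j = 2 then s*a^2*b else if j = 3 then b^3 else - s*a*b^2)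
     else if i = 2 then (if j = 1 then s*a^2*c else if j = 2 then a^2*d+2*a*b*c else if j = 3 then s*b^2*d else - (2*a*b*d + b^2*c))
     else if i = 3 then (if j = 1 then c^3 else if j = 2 then s*c^2*d else if j = 3 then d^3 else - s*c*d^2)
     else (if j = 1 then - s*a*c^2 else if j = 2 then -(2*a*c*d+b*c^2) else if j = 3 then - s*b*d^2 else a*d^2+2*b*c*d)))"

lemma sqrt3: "complex_of_real (sqrt 3) * complex_of_real (sqrt 3) = 3"
  "complex_of_real (sqrt 3) * (complex_of_real (sqrt 3) * x) = 3 * x"
proof -
  show "complex_of_real (sqrt 3) * complex_of_real (sqrt 3) = 3"
    by (metis abs_numeral of_real_mult of_real_numeral real_sqrt_abs2 real_sqrt_mult)
  then show "complex_of_real (sqrt 3) * (complex_of_real (sqrt 3) * x) = 3 * x"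
    by (metis mult.assoc)
qed

lemma R4mat: "R4mat g *v cube v = cube (g *v v)"
  by (simp add: vec_eq_iff forall_4 matrix_vector_mult_def sum_4 sum_2 cube_def R4mat_def Let_def
      power2_eq_square power3_eq_cube algebra_simps sqrt3)

lemma cube_ext:
  fixes M N :: "complex^4^'m"
  assumes "\<And>v. M *v cube v = N *v cube v"
  shows "M = N"
proof -
  have "M $ i $ j = N $ i $ j" for i j
  proof -
    define D where "D = M $ i - N $ i"
    have D: "D$1 * x^3 + D$2 * (of_real (sqrt 3) * x^2 * y) + D$3 * y^3
        - D$4 * (of_real (sqrt 3) * x * y^2) = 0" for x y
      using arg_cong[OF assms[of "vector [x, y]"], of "\<lambda>u. u $ i"]
      by (simp add: D_def matrix_vector_mult_def sum_4 cube_def vector_2 algebra_simps)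
    have s: "complex_of_real (sqrt 3) \<noteq> 0" by simp
    have 1: "D$1 = 0" and 3: "D$3 = 0" using D[of 1 0] D[of 0 1] by auto
    have "of_real (sqrt 3) * (D$2 - D$4) = 0" "of_real (sqrt 3) * (D$2 + D$4) = 0"
      using D[of 1 1] D[of "-1" 1] 1 3 by (auto simp: algebra_simps)
    then have "D$2 = D$4" "D$2 = - D$4" using s by (auto simp: eq_neg_iff_add_eq_0)
    then have "D$2 = 0" "D$4 = 0" by auto
    then have "\<forall>j. D $ j = 0" using 1 3 unfolding forall_4 by simp
    then show ?thesis by (simp add: D_def)
  qed
  then show ?thesis by (simp add: vec_eq_iff)
qed

lemma R4_eq: "R4 g = R4mat g" unfolding R4_def
    by (rule the_equality) (auto simp: R4mat intro: cube_ext)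

lemma R4_cube: "R4 g *v cube v = cube (g *v v)"
  by (simp add: R4_eq R4mat)

lemma R4_mult: "R4 (g ** h) = R4 g ** R4 h"
  by (rule cube_ext) (metis R4_cube matrix_vector_mul_assoc)

lemma R4_one: "R4 (mat 1) = mat 1"
  by (rule cube_ext) (simp add: R4_cube)


lemma R4_dagger: "R4 (g\<^sup>\<dagger>) = (R4 g)\<^sup>\<dagger>"
  unfolding R4_eq
  by (simp add: vec_eq_iff forall_4 conj_transpose_def transpose_def R4mat_def Let_def)

lemma R4_J:
  assumes "g \<in> carrier SU2"
  shows "symplectic_J ** R4 g = map_matrix cnj (R4 g) ** symplectic_J"
proof -
  have e: "g$1$2 = - cnj (g$2$1)" "g$2$2 = cnj (g$1$1)" using assms SU2_iff by auto
  show ?thesis unfolding R4_eq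
    by (simp add: e vec_eq_iff forall_4 matrix_matrix_mult_def sum_4 symplectic_J_def R4mat_def Let_def)
qed

lemma R4_unitary:
  assumes "g \<in> carrier SU2"
  shows "unitary_matrix (R4 g)"
  using assms unfolding unitary_matrix_def SU_def
  by (auto simp: R4_dagger[symmetric] R4_mult[symmetric] R4_one unitary_matrix_def)

lemma R4_Sp4:
  assumes "g \<in> carrier SU2"
  shows "R4 g \<in> carrier Sp4"
proof -
  have u: "(R4 g)\<^sup>\<dagger> ** R4 g = mat 1" using R4_unitary[OF assms] by (simp add: unitary_matrix_def)
  have "transpose (R4 g) ** symplectic_J ** R4 g = transpose (R4 g) ** map_matrix cnj (R4 g) ** symplectic_J"
    by (metis R4_J assms matrix_mul_assoc)
  also have "transpose (R4 g) ** map_matrix cnj (R4 g) = map_matrix cnj ((R4 g)\<^sup>\<dagger> ** R4 g)"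
    by (simp add: vec_eq_iff matrix_matrix_mult_def conj_transpose_def transpose_def)
  also have "\<dots> = mat 1" by (simp add: u vec_eq_iff mat_def)
  finally show ?thesis using R4_unitary[OF assms] by (simp add: Sp4_def)
qed

lemma R4_hom: "R4 \<in> hom SU2 Sp4"
proof -
  have "mult SU2 = (**)" "mult Sp4 = (**)" by (auto simp: SU_def Sp4_def)
  then show ?thesis by (auto simp: hom_def R4_Sp4 R4_mult)
qed

lemma R4_irreducible:
  assumes W: "vec.subspace W" and inv: "\<And>g w. g \<in> carrier SU2 \<Longrightarrow> w \<in> W \<Longrightarrow> R4 g *v w \<in> W"
  shows "W = {0} \<or> W = UNIV"
proof (cases "W = {0}")
  case False
  define z where "z = Complex (1 / sqrt 2) (1 / sqrt 2)"
  have z2: "z^2 = \<i>" by (simp add: z_def complex_eq_iff power2_eq_square)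
  have nz: "cmod z = 1" by (simp add: z_def cmod_def power_divide)
  have cz: "cnj z = - \<i> * z" by (simp add: z_def complex_eq_iff)
  have z0: "z \<noteq> 0" using nz by auto
  have z3: "z^3 = \<i> * z" using z2 by (simp add: power3_eq_cube power2_eq_square)
  define t :: "complex^2^2" where "t = vector [vector [z, 0], vector [0, cnj z]]"
  have t: "t \<in> carrier SU2" by (simp add: SU2_iff t_def nz)
  have R4t: "R4 t *v w = (\<chi> k. (if k = 1 then \<i> else if k = 2 then 1 else if k = 3 then -1 else - \<i>) * z * w$k)" for w
    unfolding R4_eq
    by (simp add: vec_eq_iff forall_4 matrix_vector_mult_def sum_4 R4mat_def Let_def t_def vector_2 cz z3 power_mult_distrib z2 power3_eq_cube[of "\<i>"])
  have step: "(\<chi> k. ((if k = 1 then \<i> else if k = 2 then 1 else if k = 3 then -1 else - \<i>) - c) * w$k) \<in> W"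
    if "w \<in> W" for c w
  proof -
    have "(inverse z) *s (R4 t *v w) - c *s w \<in> W"
      using that W inv[OF t] by (intro vec.subspace_diff vec.subspace_scale) auto
    moreover have "(inverse z) *s (R4 t *v w) - c *s w =
       (\<chi> k. ((if k = 1 then \<i> else if k = 2 then 1 else if k = 3 then -1 else - \<i>) - c) * w$k)"
      unfolding R4t using z0 by (simp add: vec_eq_iff field_simps)
    ultimately show ?thesis by simp
  qed
  have proj: "axis k 1 \<in> W" if "w \<in> W" "w $ k \<noteq> 0" for k w
  proof -
    define lam :: "4 \<Rightarrow> complex" where "lam k = (if k = 1 then \<i> else if k = 2 then 1 else if k = 3 then -1 else - \<i>)" for k
    have step': "(\<chi> k. (lam k - c) * w$k) \<in> W" if "w \<in> W" for c w
      using step[OF that] by (simp add: lam_def)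
    have *: "(\<chi> j. (lam j - lam a) * ((lam j - lam b) * ((lam j - lam c) * w $ j))) \<in> W" for a b c
      using step'[OF step'[OF step'[OF that(1)]], of "lam a" "lam b" "lam c"] by simp
    have **: "\<exists>a b c. (\<forall>j. j = k \<or> j = a \<or> j = b \<or> j = c) \<and> a \<noteq> k \<and> b \<noteq> k \<and> c \<noteq> k"
    proof -
      consider "k = 1" | "k = 2" | "k = 3" | "k = 4" using exhaust_4 by blast
      then show ?thesis
      proof cases
        case 1 show ?thesis by (rule exI[of _ 2], rule exI[of _ 3], rule exI[of _ 4]) (simp add: 1 forall_4)
      next
        case 2 show ?thesis by (rule exI[of _ 1], rule exI[of _ 3], rule exI[of _ 4]) (simp add: 2 forall_4)
      next
        case 3 show ?thesis by (rule exI[of _ 1], rule exI[of _ 2], rule exI[of _ 4]) (simp add: 3 forall_4)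
      next
        case 4 show ?thesis by (rule exI[of _ 1], rule exI[of _ 2], rule exI[of _ 3]) (simp add: 4 forall_4)
      qed
    qed
    then obtain a b c where abc: "\<And>j. j = k \<or> j = a \<or> j = b \<or> j = c" "a \<noteq> k" "b \<noteq> k" "c \<noteq> k"
      by auto
    have lam_inj: "lam i = lam j \<Longrightarrow> i = j" for i j
      using exhaust_4[of i] exhaust_4[of j]
      by (auto simp: lam_def complex_eq_iff split: if_splits)
    define q where "q = (lam k - lam a) * ((lam k - lam b) * ((lam k - lam c) * w $ k))"
    have q: "q \<noteq> 0" using that abc lam_inj unfolding q_def by force
    have "(\<chi> j. (lam j - lam a) * ((lam j - lam b) * ((lam j - lam c) * w $ j))) = q *s axis k 1"
      using abc by (auto simp: vec_eq_iff axis_def q_def)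
    then have "inverse q *s (q *s axis k 1) \<in> W"
      using *[of a b c] W by (metis vec.subspace_scale)
    then show ?thesis using q by simp
  qed
  obtain w where "w \<in> W" "w \<noteq> 0" using False W vec.subspace_0 by blast
  then obtain k where k: "axis k 1 \<in> W" using proj by (auto simp: vec_eq_iff)
  define r where "r = complex_of_real (1 / sqrt 2)"
  define h :: "complex^2^2" where "h = vector [vector [r, -r], vector [r, r]]"
  have h: "h \<in> carrier SU2" by (simp add: SU2_iff h_def r_def norm_divide power_divide)
  have r0: "r \<noteq> 0" by (simp add: r_def)
  have nzc: "\<forall>j k. R4 h $ j $ k \<noteq> 0"
    using r0 unfolding R4_eq R4mat_def Let_def forall_4
    by (simp add: h_def power2_eq_square power3_eq_cube)
  have "(R4 h *v axis k 1) $ j \<noteq> 0" for j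
    using nzc by (simp add: matrix_vector_mult_def axis_def if_distrib cong: if_cong)
  then have ax: "axis j 1 \<in> W" for j using proj[of "R4 h *v axis k 1" j] inv[OF h k] by auto
  have "v \<in> W" for v
  proof -
    have "(\<Sum>j\<in>UNIV. v$j *s axis j 1) \<in> W"
      using W ax by (intro vec.subspace_sum vec.subspace_scale) auto
    moreover have "(\<Sum>j\<in>UNIV. v$j *s axis j 1) = v"
      by (simp add: basis_expansion)
    ultimately show ?thesis by simp
  qed
  then show ?thesis by auto
qed simp


definition act3 :: "complex^2^2 \<Rightarrow> complex^3^3 \<Rightarrow> complex^3^3"
  where "act3 g = (\<lambda>B \<in> carrier SU3. R3 g ** B ** matrix_inv (R3 g))"

definition act4 :: "complex^2^2 \<Rightarrow> complex^4^4 \<Rightarrow> complex^4^4"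
  where "act4 g = (\<lambda>B \<in> carrier Sp4. R4 g ** B ** matrix_inv (R4 g))"

definition largest_finite_stabilizer ::
    "('a, 'm) monoid_scheme \<Rightarrow> 'b set \<Rightarrow> ('a \<Rightarrow> 'b \<Rightarrow> 'b) \<Rightarrow> 'a set \<Rightarrow> bool"
  where "largest_finite_stabilizer G E \<phi> H \<longleftrightarrow>
    (\<exists>x \<in> E. H = stabilizer G \<phi> x) \<and> finite H \<and>
    (\<forall>x \<in> E. finite (stabilizer G \<phi> x) \<longrightarrow> card (stabilizer G \<phi> x) \<le> card H)"

definition quat_i :: "complex^2^2" where "quat_i = vector [vector [\<i>, 0], vector [0, -\<i>]]"
definition quat_j :: "complex^2^2" where "quat_j = vector [vector [0, 1], vector [-1, 0]]"
definition quat_k :: "complex^2^2" where "quat_k = vector [vector [0, \<i>], vector [\<i>, 0]]"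

definition Q4 :: "(complex^2^2) set"
  where "Q4 = {mat 1, - mat 1, quat_i, - quat_i, quat_j, - quat_j, quat_k, - quat_k}"

definition tetrahedron :: "(real^3) set"
  where "tetrahedron = {vector [1, 1, 1], vector [1, -1, -1], vector [-1, 1, -1], vector [-1, -1, 1]}"

definition tetrahedral_rotations :: "(real^3^3) set"
  where "tetrahedral_rotations = {A. rotation_matrix A \<and> (*v) A ` tetrahedron = tetrahedron}"

definition BA4 :: "(complex^2^2) set"
  where "BA4 = {g \<in> carrier SU2. cover g \<in> tetrahedral_rotations}"

end

theory Submission
  imports Defs
begin

text \<open>
  The stabiliser of \<open>B\<close> consists of the \<open>g\<close> for which \<open>R g\<close> commutes with \<open>B\<close>, where \<open>R\<close> is the
  representation at hand; elements of \<open>SU(2)\<close> are treated as unit quaternions.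

  Finiteness constrains the real parts that can occur. Up to conjugation \<open>g\<close> is
  diagonal, with eigenvalues \<open>cos \<theta> \<plusminus> i sin \<theta>\<close>. If the eigenvalues of \<open>R g\<close> are distinct, then whatever
  commutes with \<open>R g\<close> commutes with the image of the whole diagonal torus, so the stabiliser is
  infinite. The eigenvalues have angles \<open>0, \<plusminus>2\<theta>\<close> for \<open>R3\<close> and \<open>\<plusminus>\<theta>, \<plusminus>3\<theta>\<close> for \<open>R4\<close>. Hence the real parts of
  the elements of a finite stabiliser lie in \<open>{0, \<plusminus>1}\<close> for \<open>R3\<close> (\<open>R3_torus\<close>) and in
  \<open>{0, \<plusminus>1/2, \<plusminus>1}\<close> for \<open>R4\<close> (\<open>R4_torus\<close>); the link is \<open>finite_centralizer_real_part\<close>.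

  A finite group \<open>H\<close> of unit quaternions with such real parts is small, by a dichotomy. If \<open>H\<close> has two
  orthogonal pure elements \<open>p, q\<close>, then \<open>1, p, q, pq\<close> is an orthonormal basis inside \<open>H\<close>, so every
  coordinate of an element of \<open>H\<close> in this basis is again a real part of an element of \<open>H\<close>. Conjugating
  \<open>p, q\<close> to \<open>i, j\<close> puts \<open>H\<close> inside \<open>Q4\<close>, respectively inside the 24 Hurwitz units.
  If \<open>H\<close> has no such pair, multiplication by one pure element maps
  the pure elements injectively to the other ones, and there are at most two,
  respectively six, of these; so \<open>H\<close> has order at most 4, respectively 12
  (\<open>conj_into_Q4\<close>, \<open>conj_into_hurwitz_units\<close>).

  The bounds 8 and 24 are attained by explicit matrices whose stabilisers are exactly \<open>Q4\<close>
  (\<open>centralizer_witness3\<close>) and the group of Hurwitz units (\<open>centralizer_witness4\<close>), which is \<open>BA4\<close>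
  (\<open>BA4_eq_hurwitz_units\<close>). Equality in the bounds forces a stabiliser of maximal order to be conjugate to
  these groups, hence isomorphic to them.
\<close>

section \<open>Quaternion coordinates on SU(2)\<close>

text \<open>The quaternion \<open>a + bi + cj + dk\<close> in the basis \<open>mat 1\<close>, \<open>quat_i\<close>, \<open>quat_j\<close>, \<open>quat_k\<close>.\<close>

definition quat :: "real \<Rightarrow> real \<Rightarrow> real \<Rightarrow> real \<Rightarrow> complex^2^2"
  where "quat a b c d =
    vector [vector [Complex a b, Complex c d], vector [Complex (-c) d, Complex a (-b)]]"

text \<open>The Euclidean inner product of \<open>g\<close> and \<open>h\<close> is the real part of
  \<open>g ** h\<^sup>\<dagger>\<close>; when \<open>g\<close> and \<open>h\<close> are pure, that is of real part 0, it is minus the real part of \<open>g ** h\<close>.\<close>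

definition real_part :: "complex^2^2 \<Rightarrow> real"
  where "real_part g = Re (g$1$1)"

lemma quat_eq_iff: "quat a b c d = quat a' b' c' d' \<longleftrightarrow> a = a' \<and> b = b' \<and> c = c' \<and> d = d'"
  by (auto simp: quat_def vec_eq_iff forall_2)

lemma quat_mult:
  "quat a b c d ** quat a' b' c' d' =
   quat (a*a' - b*b' - c*c' - d*d') (a*b' + b*a' + c*d' - d*c')
        (a*c' - b*d' + c*a' + d*b') (a*d' + b*c' - c*b' + d*a')"
  by (simp add: quat_def vec_eq_iff forall_2 matrix_matrix_mult_def sum_2 complex_eq_iff)

lemma quat_dagger: "(quat a b c d)\<^sup>\<dagger> = quat a (-b) (-c) (-d)"
  by (simp add: quat_def vec_eq_iff forall_2 conj_transpose_def transpose_def complex_eq_iff)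

lemma quat_uminus: "- quat a b c d = quat (-a) (-b) (-c) (-d)"
  by (simp add: quat_def vec_eq_iff forall_2 complex_eq_iff)

lemma quat_diff: "quat a b c d - quat a' b' c' d' = quat (a - a') (b - b') (c - c') (d - d')"
  by (simp add: quat_def vec_eq_iff forall_2 complex_eq_iff)

lemma quat_one: "mat 1 = quat 1 0 0 0"
  by (simp add: quat_def vec_eq_iff forall_2 mat_def complex_eq_iff)

lemma quat_i: "quat_i = quat 0 1 0 0"
  by (simp add: quat_def quat_i_def vec_eq_iff forall_2 complex_eq_iff)

lemma quat_j: "quat_j = quat 0 0 1 0"
  by (simp add: quat_def quat_j_def vec_eq_iff forall_2 complex_eq_iff)

lemma quat_k: "quat_k = quat 0 0 0 1"
  by (simp add: quat_def quat_k_def vec_eq_iff forall_2 complex_eq_iff)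

lemma real_part_quat [simp]: "real_part (quat a b c d) = a"
  by (simp add: real_part_def quat_def)

lemma quat_in_SU2 [simp]: "quat a b c d \<in> carrier SU2 \<longleftrightarrow> a^2 + b^2 + c^2 + d^2 = 1"
  by (auto simp: SU2_iff quat_def cmod_power2 complex_eq_iff)

lemma SU2_quatE:
  assumes "g \<in> carrier SU2"
  obtains a b c d where "g = quat a b c d" "a^2 + b^2 + c^2 + d^2 = 1"
proof -
  let ?q = "quat (Re (g$1$1)) (Im (g$1$1)) (- Re (g$2$1)) (Im (g$2$1))"
  have "g = ?q"
    using assms by (auto simp: SU2_iff quat_def vec_eq_iff forall_2 complex_eq_iff)
  then show ?thesis
    using that assms by (metis quat_in_SU2)
qed

lemma SU2_one [simp]: "mat 1 \<in> carrier SU2"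
  by (simp add: quat_one)

lemma SU2_dagger [simp]: "g \<in> carrier SU2 \<Longrightarrow> g\<^sup>\<dagger> \<in> carrier SU2"
  by (elim SU2_quatE) (simp add: quat_dagger)

lemma SU2_uminus [simp]: "g \<in> carrier SU2 \<Longrightarrow> - g \<in> carrier SU2"
  by (elim SU2_quatE) (simp add: quat_uminus)

lemma SU2_dagger_inverse [simp]:
  assumes "g \<in> carrier SU2"
  shows "g\<^sup>\<dagger> ** g = mat 1" "g ** g\<^sup>\<dagger> = mat 1"
  using assms by (simp_all add: SU_def unitary_matrix_def)

lemma dagger_dagger [simp]: "(A\<^sup>\<dagger>)\<^sup>\<dagger> = A"
  by (simp add: conj_transpose_def vec_eq_iff transpose_def)

lemma SU2_cancel [simp]:
  assumes "g \<in> carrier SU2"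
  shows "g\<^sup>\<dagger> ** (g ** h) = h" "g ** (g\<^sup>\<dagger> ** h) = h"
  using assms by (simp_all add: matrix_mul_assoc)

lemma SU2_conj_mult:
  assumes "s \<in> carrier SU2"
  shows "(s\<^sup>\<dagger> ** g ** s) ** (s\<^sup>\<dagger> ** h ** s) = s\<^sup>\<dagger> ** (g ** h) ** s"
  using assms by (simp add: matrix_mul_assoc[symmetric])

lemma real_part_uminus [simp]: "real_part (- g) = - real_part g"
  by (simp add: real_part_def)

lemma real_part_diff [simp]: "real_part (g - h) = real_part g - real_part h"
  by (simp add: real_part_def)

lemma real_part_one [simp]: "real_part (mat 1) = 1"
  by (simp add: quat_one)

lemma real_part_dagger [simp]: "real_part (g\<^sup>\<dagger>) = real_part g"
  by (simp add: real_part_def conj_transpose_def transpose_def)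

lemma real_part_commute:
  assumes "g \<in> carrier SU2" "h \<in> carrier SU2"
  shows "real_part (g ** h) = real_part (h ** g)"
  using assms by (elim SU2_quatE) (simp add: quat_mult)

lemma real_part_conj:
  assumes "s \<in> carrier SU2" "g \<in> carrier SU2"
  shows "real_part (s\<^sup>\<dagger> ** g ** s) = real_part g"
  using real_part_commute[of "s\<^sup>\<dagger> ** g" s] assms by (simp add: SU2_mult)

text \<open>The sum of \<open>h\<close> and its conjugate is the scalar \<open>2 * real_part h\<close>.\<close>

lemma real_part_parallelogram:
  assumes "g \<in> carrier SU2" "h \<in> carrier SU2"
  shows "real_part (g ** h) + real_part (g ** h\<^sup>\<dagger>) = 2 * real_part g * real_part h"
  using assms by (elim SU2_quatE) (simp add: quat_mult quat_dagger)

lemma real_part_eq_1: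
  assumes "g \<in> carrier SU2"
  shows "real_part g = 1 \<longleftrightarrow> g = mat 1" "real_part g = -1 \<longleftrightarrow> g = - mat 1"
  using assms
  by (elim SU2_quatE; auto simp: quat_one quat_uminus quat_eq_iff add_nonneg_eq_0_iff)+

text \<open>This is the source of orthogonal pure pairs: a unit quaternion \<open>u\<close> of real part \<open>1/2\<close> satisfies
  \<open>u\<^sup>2 = u - 1\<close>, so by cyclicity the real part of \<open>gh \<cdot> hg\<close> is that of \<open>g\<^sup>2h\<^sup>2 = (g - 1)(h - 1)\<close>, which vanishes
  if \<open>gh\<close> is pure.\<close>

lemma orthogonal_products:
  assumes g: "g \<in> carrier SU2" "real_part g = 1/2" and h: "h \<in> carrier SU2" "real_part h = 1/2"
    and gh: "real_part (g ** h) = 0"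
  shows "real_part ((g ** h) ** (h ** g)) = 0"
proof -
  have sq: "u ** u = u - mat 1" if u: "u \<in> carrier SU2" "real_part u = 1/2" for u
  proof -
    obtain a b c d where q: "u = quat a b c d" "a^2 + b^2 + c^2 + d^2 = 1"
      using u(1) by (rule SU2_quatE)
    moreover from this have "a = 1/2" using u(2) by simp
    ultimately show ?thesis
      by (simp add: quat_mult quat_one quat_diff quat_eq_iff power2_eq_square)
  qed
  have "real_part ((g ** h) ** (h ** g)) = real_part (g ** ((g ** h) ** h))"
    using real_part_commute[of "g ** h ** h" g] g h by (simp add: SU2_mult matrix_mul_assoc)
  also have "g ** ((g ** h) ** h) = (g ** g) ** (h ** h)"
    by (simp add: matrix_mul_assoc)
  also have "\<dots> = (g - mat 1) ** (h - mat 1)"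
    using g h sq by simp
  also have "\<dots> = (g ** h - g) - (h - mat 1)"
    by (simp add: matrix_matrix_mult_def vec_eq_iff mat_def forall_2 sum_2 algebra_simps)
  finally show ?thesis using g h gh by simp
qed

text \<open>The maximal torus theorem for \<open>SU(2)\<close>. With \<open>g = a + v\<close> and \<open>n\<close> the norm of the vector part \<open>v\<close>, the
  quaternion \<open>n - vi\<close> intertwines \<open>v\<close> with \<open>ni\<close>; it vanishes only for \<open>v = -ni\<close>, where \<open>j\<close> does the job.\<close>

lemma SU2_conj_diagonal:
  assumes "g \<in> carrier SU2"
  obtains s y where "s \<in> carrier SU2" "y \<ge> 0" "s\<^sup>\<dagger> ** g ** s = quat (real_part g) y 0 0"
proof -
  obtain a b c d where q: "g = quat a b c d" using assms by (rule SU2_quatE)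
  define n where "n = sqrt (b^2 + c^2 + d^2)"
  have n: "n \<ge> 0" "n^2 = b^2 + c^2 + d^2" by (simp_all add: n_def)
  have "\<exists>s \<in> carrier SU2. g ** s = s ** quat a n 0 0"
  proof (cases "n + b = 0")
    case True
    then have b: "b = -n" by simp
    then have "c^2 + d^2 = 0" using n(2) by simp
    then have "c = 0" "d = 0" by (simp_all add: sum_power2_eq_zero_iff)
    with b show ?thesis
      by (intro bexI[of _ "quat 0 0 1 0"]) (simp_all add: q quat_mult quat_eq_iff)
  next
    case False
    define m where "m = sqrt ((n + b)^2 + d^2 + c^2)"
    have pos: "(n + b)^2 + d^2 + c^2 > 0"
      using False by (simp add: add_pos_nonneg)
    then have m: "m > 0" "m^2 = (n + b)^2 + d^2 + c^2"
      by (simp_all add: m_def)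
    let ?s = "quat ((n + b) / m) 0 (- d / m) (c / m)"
    have "((n + b) / m)^2 + 0^2 + (- d / m)^2 + (c / m)^2 = ((n + b)^2 + d^2 + c^2) / m^2"
      by (simp add: power_divide) (simp add: add_divide_distrib)
    also have "\<dots> = 1"
      using m pos by simp
    finally have "?s \<in> carrier SU2"
      by simp
    moreover have "g ** ?s = ?s ** quat a n 0 0"
      using m(1) n(2) by (simp add: q quat_mult quat_eq_iff field_simps) (simp add: power2_eq_square algebra_simps)
    ultimately show ?thesis by blast
  qed
  then obtain s where s: "s \<in> carrier SU2" "g ** s = s ** quat a n 0 0" by blast
  then have "s\<^sup>\<dagger> ** g ** s = quat a n 0 0"
    by (simp add: matrix_mul_assoc[symmetric])
  then show ?thesis using that s n q by simp
qed

text \<open>Rotations act transitively on orthonormal pairs: first turn \<open>p\<close> into \<open>i\<close>, then \<open>q\<close>, which has become a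
  unit vector of the \<open>j\<close>-\<open>k\<close>-plane, into \<open>j\<close> by a rotation about \<open>i\<close>.\<close>

lemma quaternion_frame:
  assumes p: "p \<in> carrier SU2" "real_part p = 0" and q: "q \<in> carrier SU2" "real_part q = 0"
    and pq: "real_part (p ** q) = 0"
  obtains s where "s \<in> carrier SU2" "s\<^sup>\<dagger> ** p ** s = quat_i" "s\<^sup>\<dagger> ** q ** s = quat_j"
proof -
  obtain s y where s: "s \<in> carrier SU2" "y \<ge> 0" "s\<^sup>\<dagger> ** p ** s = quat 0 y 0 0"
    using SU2_conj_diagonal[OF p(1)] p(2) by metis
  have "quat 0 y 0 0 \<in> carrier SU2"
    using s p SU2_mult SU2_dagger by metis
  then have sp: "s\<^sup>\<dagger> ** p ** s = quat_i"
    using s by (simp add: quat_i power2_eq_1_iff)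
  let ?q = "s\<^sup>\<dagger> ** q ** s"
  have q': "?q \<in> carrier SU2" using s q by (simp add: SU2_mult)
  have r: "real_part ?q = 0" using real_part_conj s q by simp
  have "quat_i ** ?q = s\<^sup>\<dagger> ** (p ** q) ** s"
    unfolding sp[symmetric] by (rule SU2_conj_mult[OF s(1)])
  then have r2: "real_part (quat_i ** ?q) = 0"
    using real_part_conj[of s "p ** q"] s p q pq by (simp add: SU2_mult)
  obtain c d where cd: "?q = quat 0 0 c d" "c^2 + d^2 = 1"
    using q' r r2 by (elim SU2_quatE) (auto simp: quat_i quat_mult)
  obtain t where t: "c = cos t" "d = sin t"
    using sincos_total_2pi[OF cd(2)] by metis
  \<comment> \<open>Conjugation by \<open>u\<close> rotates the \<open>j\<close>-\<open>k\<close>-plane by twice the angle of \<open>u\<close>.\<close>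
  define u where "u = quat (cos (t/2)) (sin (t/2)) 0 0"
  have u: "u \<in> carrier SU2" by (simp add: u_def)
  define x y where "x = cos (t/2)" and "y = sin (t/2)"
  have xy: "x * x + y * y = 1"
    unfolding x_def y_def by (metis power2_eq_square sin_cos_squared_add2)
  have cs: "c = x * x - y * y" "d = 2 * x * y"
    using cos_double[of "t/2"] sin_double[of "t/2"] t by (simp_all add: power2_eq_square x_def y_def)
  have ui: "u\<^sup>\<dagger> ** quat_i ** u = quat_i"
    using xy unfolding u_def quat_i quat_dagger quat_mult quat_eq_iff x_def[symmetric] y_def[symmetric]
    by simp
  have "x * (x * x + y * y) = x" "y * (x * x + y * y) = y"
    "(x * x + y * y) * (x * x + y * y) = 1"
    using xy by simp_all
  then have uj: "u\<^sup>\<dagger> ** ?q ** u = quat_j"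
    unfolding cd cs u_def quat_j quat_dagger quat_mult quat_eq_iff x_def[symmetric] y_def[symmetric]
    by (simp add: algebra_simps) (rule xy)
  have dag: "(s ** u)\<^sup>\<dagger> = u\<^sup>\<dagger> ** s\<^sup>\<dagger>"
    by (simp add: conj_transpose_def vec_eq_iff transpose_def matrix_matrix_mult_def mult.commute)
  show ?thesis
  proof (rule that[of "s ** u"])
    show "s ** u \<in> carrier SU2" using s u by (simp add: SU2_mult)
    show "(s ** u)\<^sup>\<dagger> ** p ** (s ** u) = quat_i" using ui
      unfolding dag sp[symmetric] by (simp add: matrix_mul_assoc)
    show "(s ** u)\<^sup>\<dagger> ** q ** (s ** u) = quat_j" using uj
      unfolding dag by (simp add: matrix_mul_assoc)
  qed
qed

lemma SU2_conj_inj: "s \<in> carrier SU2 \<Longrightarrow> inj (\<lambda>g. s\<^sup>\<dagger> ** g ** s)"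
proof (rule injI)
  fix g h assume s: "s \<in> carrier SU2" and "s\<^sup>\<dagger> ** g ** s = s\<^sup>\<dagger> ** h ** s"
  then have "s ** (s\<^sup>\<dagger> ** g ** s) ** s\<^sup>\<dagger> = s ** (s\<^sup>\<dagger> ** h ** s) ** s\<^sup>\<dagger>"
    by simp
  then show "g = h"
    using s by (simp add: matrix_mul_assoc[symmetric])
qed

lemma SU2_conj_is_iso:
  assumes s: "s \<in> carrier SU2" and im: "(\<lambda>g. s\<^sup>\<dagger> ** g ** s) ` H = K"
  shows "SU2\<lparr>carrier := H\<rparr> \<cong> SU2\<lparr>carrier := K\<rparr>"
proof (rule is_isoI)
  have "mult SU2 = (**)" by (simp add: SU_def)
  then show "(\<lambda>g. s\<^sup>\<dagger> ** g ** s) \<in> iso (SU2\<lparr>carrier := H\<rparr>) (SU2\<lparr>carrier := K\<rparr>)"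
    using im inj_on_subset[OF SU2_conj_inj[OF s] subset_UNIV]
    by (auto simp: iso_def hom_def SU2_conj_mult[OF s] bij_betw_def)
qed

section \<open>The quaternion group and the Hurwitz units\<close>

definition hurwitz_units :: "(complex^2^2) set"
  where "hurwitz_units = Q4 \<union> {quat a b c d |a b c d. a^2 = 1/4 \<and> b^2 = 1/4 \<and> c^2 = 1/4 \<and> d^2 = 1/4}"

lemma Q4_quat:
  "Q4 = {quat 1 0 0 0, quat (-1) 0 0 0, quat 0 1 0 0, quat 0 (-1) 0 0,
         quat 0 0 1 0, quat 0 0 (-1) 0, quat 0 0 0 1, quat 0 0 0 (-1)}"
  by (simp add: Q4_def quat_one quat_i quat_j quat_k quat_uminus)

lemma card_Q4: "card Q4 = 8" and finite_Q4: "finite Q4"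
  by (simp_all add: Q4_quat quat_eq_iff)

lemma sq_quarter: "x^2 = 1/4 \<longleftrightarrow> x = 1/2 \<or> x = -1/2" for x :: real
  using power2_eq_iff[of x "1/2"] by (simp add: power_divide)

lemma card_hurwitz_units: "card hurwitz_units = 24" and finite_hurwitz_units: "finite hurwitz_units"
proof -
  let ?S = "{x :: real. x^2 = 1/4}"
  let ?f = "\<lambda>(a, b, c, d). quat a b c d"
  let ?T = "{quat a b c d |a b c d. a^2 = 1/4 \<and> b^2 = 1/4 \<and> c^2 = 1/4 \<and> d^2 = 1/4}"
  have S: "?S = {1/2, -1/2}" unfolding sq_quarter by auto
  have fS: "finite ?S" and cS: "card ?S = 2" unfolding S by simp_all
  have T: "?T = ?f ` (?S \<times> ?S \<times> ?S \<times> ?S)"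
  proof (intro subset_antisym subsetI)
    fix x assume "x \<in> ?T"
    then obtain a b c d where "x = ?f (a, b, c, d)" "(a, b, c, d) \<in> ?S \<times> ?S \<times> ?S \<times> ?S"
      by auto
    then show "x \<in> ?f ` (?S \<times> ?S \<times> ?S \<times> ?S)" by (rule image_eqI)
  next
    fix x assume "x \<in> ?f ` (?S \<times> ?S \<times> ?S \<times> ?S)"
    then show "x \<in> ?T" by auto
  qed
  moreover have "inj_on ?f (?S \<times> ?S \<times> ?S \<times> ?S)"
    by (auto simp: inj_on_def quat_eq_iff)
  ultimately have "card ?T = 16"
    by (simp only: card_image card_cartesian_product cS)
  moreover have fT: "finite ?T" unfolding T using fS by blast
  moreover have "Q4 \<inter> ?T = {}"
    by (auto simp: Q4_quat quat_eq_iff power2_eq_square)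
  ultimately show "card hurwitz_units = 24" "finite hurwitz_units"
    using card_Q4 finite_Q4 unfolding hurwitz_units_def by (auto simp: card_Un_disjoint)
qed

lemma quat_in_Q4:
  assumes n: "a^2 + b^2 + c^2 + d^2 = 1" and one: "1 \<in> {a^2, b^2, c^2, d^2}"
  shows "quat a b c d \<in> Q4"
proof -
  have z: "y = 0 \<and> z = 0 \<and> w = 0" if "x^2 + y^2 + z^2 + w^2 = 1" "x^2 = 1" for x y z w :: real
  proof -
    have "y^2 + (z^2 + w^2) = 0" using that by linarith
    then show ?thesis by (simp add: add_nonneg_eq_0_iff)
  qed
  consider "a^2 = 1" | "b^2 = 1" | "c^2 = 1" | "d^2 = 1" using one by auto
  then show ?thesis
  proof cases
    case 1
    then show ?thesis using z[of a b c d] n by (auto simp: Q4_quat power2_eq_1_iff)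
  next
    case 2
    then show ?thesis using z[of b a c d] n by (auto simp: Q4_quat power2_eq_1_iff)
  next
    case 3
    then show ?thesis using z[of c a b d] n by (auto simp: Q4_quat power2_eq_1_iff)
  next
    case 4
    then show ?thesis using z[of d a b c] n by (auto simp: Q4_quat power2_eq_1_iff)
  qed
qed

lemma quat_in_hurwitz_units:
  assumes n: "a^2 + b^2 + c^2 + d^2 = 1" and v: "{a^2, b^2, c^2, d^2} \<subseteq> {0, 1/4, 1}"
  shows "quat a b c d \<in> hurwitz_units"
proof (cases "1 \<in> {a^2, b^2, c^2, d^2}")
  case True
  then show ?thesis using quat_in_Q4[OF n] by (simp add: hurwitz_units_def)
next
  case False
  then have "{a^2, b^2, c^2, d^2} \<subseteq> {0, 1/4}" using v by auto
  then have "a^2 \<le> 1/4" "b^2 \<le> 1/4" "c^2 \<le> 1/4" "d^2 \<le> 1/4" by auto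
  then have "a^2 = 1/4 \<and> b^2 = 1/4 \<and> c^2 = 1/4 \<and> d^2 = 1/4"
    using n by linarith
  then show ?thesis unfolding hurwitz_units_def by blast
qed

section \<open>Groups of unit quaternions with few real parts\<close>

text \<open>Subgroups of \<open>SU(2)\<close> that are full preimages of their image in \<open>SO(3)\<close>.\<close>

locale binary_subgroup =
  fixes H :: "(complex^2^2) set"
  assumes subset: "H \<subseteq> carrier SU2"
    and mult: "\<And>g h. g \<in> H \<Longrightarrow> h \<in> H \<Longrightarrow> g ** h \<in> H"
    and dagger: "\<And>g. g \<in> H \<Longrightarrow> g\<^sup>\<dagger> \<in> H"
    and minus_one: "- mat 1 \<in> H"
begin

lemma uminus: "g \<in> H \<Longrightarrow> - g \<in> H"
proof -
  assume "g \<in> H"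
  moreover have "- mat 1 ** g = - g"
    by (simp add: vec_eq_iff matrix_matrix_mult_def mat_def forall_2 sum_2)
  ultimately show ?thesis using mult minus_one by metis
qed

text \<open>The coordinates of \<open>h\<close> in the orthonormal frame \<open>1, p, q, pq\<close> are its inner products with members of
  \<open>H\<close>, hence real parts of members of \<open>H\<close>. The conjugation by \<open>s\<close> turns this frame into \<open>1, i, j, k\<close>.\<close>

lemma coordinates_in_frame:
  assumes p: "p \<in> H" "real_part p = 0" and q: "q \<in> H" "real_part q = 0"
    and pq: "real_part (p ** q) = 0"
  obtains s where "s \<in> carrier SU2"
    "\<And>h. h \<in> H \<Longrightarrow> \<exists>a b c d. s\<^sup>\<dagger> ** h ** s = quat a b c d \<and> {a, b, c, d} \<subseteq> real_part ` H
       \<and> a^2 + b^2 + c^2 + d^2 = 1"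
proof -
  obtain s where s: "s \<in> carrier SU2" and si: "s\<^sup>\<dagger> ** p ** s = quat_i" and sj: "s\<^sup>\<dagger> ** q ** s = quat_j"
    using quaternion_frame[OF _ p(2) _ q(2) pq] p q subset by blast
  have sk: "s\<^sup>\<dagger> ** (p ** q) ** s = quat_k"
    by (simp add: SU2_conj_mult[OF s, symmetric] si sj)
      (simp add: quat_i quat_j quat_k quat_mult)
  have "\<exists>a b c d. s\<^sup>\<dagger> ** h ** s = quat a b c d \<and> {a, b, c, d} \<subseteq> real_part ` H
       \<and> a^2 + b^2 + c^2 + d^2 = 1"
    if h: "h \<in> H" for h
  proof -
    have shs: "s\<^sup>\<dagger> ** h ** s \<in> carrier SU2" using s h subset by (auto intro!: SU2_mult)
    obtain a b c d where abcd: "s\<^sup>\<dagger> ** h ** s = quat a b c d" "a^2 + b^2 + c^2 + d^2 = 1"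
      using shs by (rule SU2_quatE)
    have val: "real_part (quat a b c d ** (s\<^sup>\<dagger> ** x ** s)) = - real_part (- (h ** x))"
      if "x \<in> H" for x
    proof -
      have "h ** x \<in> carrier SU2" using mult h that subset by blast
      then show ?thesis
        unfolding abcd(1)[symmetric] SU2_conj_mult[OF s] real_part_uminus
        using real_part_conj[OF s] by simp
    qed
    have "a = real_part h"
      using real_part_conj[OF s] h subset abcd(1) by (metis real_part_quat subsetD)
    moreover have "b = real_part (- (h ** p))"
      using val[OF p(1)] by (simp add: si) (simp add: quat_i quat_mult)
    moreover have "c = real_part (- (h ** q))"
      using val[OF q(1)] by (simp add: sj) (simp add: quat_j quat_mult)
    moreover have "d = real_part (- (h ** (p ** q)))"
      using val[OF mult[OF p(1) q(1)]] by (simp add: sk) (simp add: quat_k quat_mult)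
    ultimately have "{a, b, c, d} \<subseteq> real_part ` H"
      using h p q by (auto simp del: real_part_uminus intro!: imageI uminus mult)
    then show ?thesis using abcd by blast
  qed
  then show ?thesis using that s by blast
qed

text \<open>If a pure \<open>p\<close> exists, left multiplication by \<open>p\<close> sends every pure \<open>q\<close> to a non-pure element.\<close>

lemma card_le_twice_nonpure:
  assumes fin: "finite H"
    and no_pair: "\<And>p q. p \<in> H \<Longrightarrow> q \<in> H \<Longrightarrow> real_part p = 0 \<Longrightarrow> real_part q = 0 \<Longrightarrow>
      real_part (p ** q) \<noteq> 0"
  shows "card H \<le> 2 * card {h \<in> H. real_part h \<noteq> 0}"
proof -
  let ?P = "{h \<in> H. real_part h = 0}" and ?N = "{h \<in> H. real_part h \<noteq> 0}"
  have "card ?P \<le> card ?N"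
  proof (cases "?P = {}")
    case False
    then obtain p where p: "p \<in> H" "real_part p = 0" by blast
    have "inj_on ((**) p) ?P"
      using p subset by (intro inj_on_inverseI[of _ "(**) (p\<^sup>\<dagger>)"]) auto
    moreover have "(**) p ` ?P \<subseteq> ?N"
      using p no_pair mult by auto
    ultimately show ?thesis
      using fin by (intro card_inj_on_le[of "(**) p"]) auto
  next
    case True
    then show ?thesis by (simp only: card.empty)
  qed
  moreover have "card H = card ?P + card ?N"
    using fin by (subst card_Un_disjoint[symmetric]) (auto intro!: arg_cong[of _ _ card])
  ultimately show ?thesis by linarith
qed

lemma conj_into_Q4:
  assumes fin: "finite H" and val: "real_part ` H \<subseteq> {0, 1, -1}"
  shows "card H \<le> 4 \<or> (\<exists>s \<in> carrier SU2. (\<lambda>g. s\<^sup>\<dagger> ** g ** s) ` H \<subseteq> Q4)"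
proof (cases "\<exists>p \<in> H. \<exists>q \<in> H. real_part p = 0 \<and> real_part q = 0 \<and> real_part (p ** q) = 0")
  case True
  then obtain p q where "p \<in> H" "real_part p = 0" "q \<in> H" "real_part q = 0" "real_part (p ** q) = 0"
    by blast
  from coordinates_in_frame[OF this] obtain s where s: "s \<in> carrier SU2"
    "\<And>h. h \<in> H \<Longrightarrow> \<exists>a b c d. s\<^sup>\<dagger> ** h ** s = quat a b c d \<and> {a, b, c, d} \<subseteq> real_part ` H
       \<and> a^2 + b^2 + c^2 + d^2 = 1"
    by blast
  have "s\<^sup>\<dagger> ** h ** s \<in> Q4" if h_in: "h \<in> H" for h
  proof -
    obtain a b c d where h: "s\<^sup>\<dagger> ** h ** s = quat a b c d" "{a, b, c, d} \<subseteq> real_part ` H"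
      and n: "a^2 + b^2 + c^2 + d^2 = 1"
      using s(2)[OF h_in] by blast
    have "x^2 = 0 \<or> x^2 = 1" if "x \<in> {a, b, c, d}" for x
      using h(2) val that by fastforce
    from this[of a] this[of b] this[of c] this[of d]
    have "1 \<in> {a^2, b^2, c^2, d^2}" using n by auto
    then show ?thesis using quat_in_Q4[OF n] h by simp
  qed
  then show ?thesis using s(1) by blast
next
  case False
  have "{h \<in> H. real_part h \<noteq> 0} \<subseteq> {mat 1, - mat 1}"
    using val real_part_eq_1 subset by auto
  then have "card {h \<in> H. real_part h \<noteq> 0} \<le> card {mat 1, - mat 1 :: complex^2^2}"
    by (intro card_mono) auto
  also have "\<dots> \<le> 2" by (simp add: card_insert_if)
  finally show ?thesis
    using card_le_twice_nonpure[OF fin] False by fastforce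
qed

text \<open>Without orthogonal pure pairs the elements of real part \<open>1/2\<close> are some \<open>u\<close> and its inverse: for
  another such \<open>w\<close>, the real parts of \<open>uw\<close> and \<open>uw\<^sup>\<dagger>\<close> sum to \<open>1/2\<close> and are both nonzero by
  \<open>orthogonal_products\<close>, so among the admissible values one of them is \<open>1\<close>. Together with \<open>\<plusminus>1\<close> and signs this leaves
  at most six non-pure elements.\<close>

lemma conj_into_hurwitz_units:
  assumes fin: "finite H" and val: "real_part ` H \<subseteq> {0, 1/2, -1/2, 1, -1}"
  shows "card H \<le> 12 \<or> (\<exists>s \<in> carrier SU2. (\<lambda>g. s\<^sup>\<dagger> ** g ** s) ` H \<subseteq> hurwitz_units)"
proof (cases "\<exists>p \<in> H. \<exists>q \<in> H. real_part p = 0 \<and> real_part q = 0 \<and> real_part (p ** q) = 0")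
  case True
  then obtain p q where "p \<in> H" "real_part p = 0" "q \<in> H" "real_part q = 0" "real_part (p ** q) = 0"
    by blast
  from coordinates_in_frame[OF this] obtain s where s: "s \<in> carrier SU2"
    "\<And>h. h \<in> H \<Longrightarrow> \<exists>a b c d. s\<^sup>\<dagger> ** h ** s = quat a b c d \<and> {a, b, c, d} \<subseteq> real_part ` H
       \<and> a^2 + b^2 + c^2 + d^2 = 1"
    by blast
  have "s\<^sup>\<dagger> ** h ** s \<in> hurwitz_units" if h_in: "h \<in> H" for h
  proof -
    obtain a b c d where h: "s\<^sup>\<dagger> ** h ** s = quat a b c d" "{a, b, c, d} \<subseteq> real_part ` H"
      and n: "a^2 + b^2 + c^2 + d^2 = 1"
      using s(2)[OF h_in] by blast
    have "x^2 \<in> {0, 1/4, 1}" if "x \<in> {a, b, c, d}" for x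
    proof -
      have "x \<in> {0, 1/2, -1/2, 1, -1}" using h(2) val that by blast
      then show ?thesis by (elim insertE emptyE; simp only:; simp add: power_divide)
    qed
    then have "{a^2, b^2, c^2, d^2} \<subseteq> {0, 1/4, 1}" by blast
    then show ?thesis using quat_in_hurwitz_units[OF n] h by simp
  qed
  then show ?thesis using s(1) by blast
next
  case False
  let ?half = "{h \<in> H. real_part h = 1/2}"
  have half: "w = u \<or> w = u\<^sup>\<dagger>" if u: "u \<in> ?half" and w: "w \<in> ?half" for u w
  proof -
    have SU2: "u \<in> carrier SU2" "w \<in> carrier SU2" using u w subset by auto
    have not_pure: "real_part (u ** x) \<noteq> 0" if x: "x \<in> ?half" for x
    proof
      assume ux: "real_part (u ** x) = 0"
      moreover have xu: "real_part (x ** u) = 0"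
        using real_part_commute[of x u] ux SU2 x subset by auto
      moreover have "real_part ((u ** x) ** (x ** u)) = 0"
        using orthogonal_products[of u x] ux u x subset by auto
      ultimately show False using False u x mult by blast
    qed
    have half_values: "real_part u = 1/2" "real_part w = 1/2" using u w by simp_all
    have "real_part (u ** w) + real_part (u ** w\<^sup>\<dagger>) = 1/2"
      using real_part_parallelogram[OF SU2] unfolding half_values by simp
    moreover have "real_part (u ** w) \<in> {0, 1/2, -1/2, 1, -1}" "real_part (u ** w\<^sup>\<dagger>) \<in> {0, 1/2, -1/2, 1, -1}"
      using val u w mult dagger by (auto simp: image_subset_iff)
    moreover have "real_part (u ** w) \<noteq> 0" "real_part (u ** w\<^sup>\<dagger>) \<noteq> 0"
      using not_pure w dagger by auto
    ultimately have "real_part (u ** w) = 1 \<or> real_part (u ** w\<^sup>\<dagger>) = 1" by auto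
    then have "u ** w = mat 1 \<or> u ** w\<^sup>\<dagger> = mat 1"
      using real_part_eq_1 SU2 by (metis SU2_mult SU2_dagger)
    then show ?thesis
      using SU2 by (metis SU2_cancel(1) matrix_mul_rid dagger_dagger)
  qed
  have "\<exists>u. ?half \<subseteq> {u, u\<^sup>\<dagger>}" using half by blast
  then obtain u where u: "?half \<subseteq> {u, u\<^sup>\<dagger>}" by blast
  have "{h \<in> H. real_part h \<noteq> 0} \<subseteq> {mat 1, - mat 1, u, u\<^sup>\<dagger>, - u, - u\<^sup>\<dagger>}"
  proof
    fix h assume h: "h \<in> {h \<in> H. real_part h \<noteq> 0}"
    then consider "real_part h = 1" | "real_part h = -1" | "h \<in> ?half" | "- h \<in> ?half"
    proof -
      have "real_part h \<in> {1/2, -1/2, 1, -1}" using h val by blast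
      then show ?thesis using that h uminus by auto
    qed
    then show "h \<in> {mat 1, - mat 1, u, u\<^sup>\<dagger>, - u, - u\<^sup>\<dagger>}"
    proof cases
      case 4
      then have "- h = u \<or> - h = u\<^sup>\<dagger>" using u by auto
      then show ?thesis by (metis insertCI minus_minus)
    qed (use real_part_eq_1 h subset u in auto)
  qed
  then have "card {h \<in> H. real_part h \<noteq> 0} \<le> card {mat 1, - mat 1, u, u\<^sup>\<dagger>, - u, - u\<^sup>\<dagger>}"
    by (intro card_mono) auto
  also have "\<dots> \<le> 6" by (simp add: card_insert_if)
  finally show ?thesis
    using card_le_twice_nonpure[OF fin] False by fastforce
qed

end

section \<open>Stabilisers of the conjugation action of a representation\<close>

lemma matrix_inv_eqI:
  fixes A :: "'a::semiring_1^'n^'n"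
  assumes "A ** B = mat 1" "B ** A = mat 1"
  shows "matrix_inv A = B"
proof -
  have "A ** matrix_inv A = mat 1 \<and> matrix_inv A ** A = mat 1"
    unfolding matrix_inv_def by (rule someI[of _ B]) (use assms in blast)
  then show ?thesis
    by (metis assms(2) matrix_mul_assoc matrix_mul_lid matrix_mul_rid)
qed

text \<open>For an irreducible representation the last condition follows from Schur's lemma, as \<open>-1\<close> is central of order 2. It puts \<open>-1\<close> into every
  stabiliser.\<close>

locale SU2_rep =
  fixes R :: "complex^2^2 \<Rightarrow> complex^'n^'n"
  assumes R_mult: "\<And>g h. g \<in> carrier SU2 \<Longrightarrow> h \<in> carrier SU2 \<Longrightarrow> R (g ** h) = R g ** R h"
    and R_one: "R (mat 1) = mat 1"
    and R_minus_one: "R (- mat 1) = mat 1 \<or> R (- mat 1) = - mat 1"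
begin

definition centralizer :: "complex^'n^'n \<Rightarrow> (complex^2^2) set"
  where "centralizer B = {g \<in> carrier SU2. R g ** B = B ** R g}"

lemma R_dagger_inverse:
  assumes "g \<in> carrier SU2"
  shows "R (g\<^sup>\<dagger>) ** R g = mat 1" "R g ** R (g\<^sup>\<dagger>) = mat 1"
  using assms by (simp_all add: R_mult[symmetric] R_one)

lemma R_cancel:
  assumes "g \<in> carrier SU2"
  shows "R (g\<^sup>\<dagger>) ** (R g ** A) = A" "R g ** (R (g\<^sup>\<dagger>) ** A) = A"
  using assms by (simp_all add: R_dagger_inverse matrix_mul_assoc)

lemma conj_eq_iff:
  assumes "g \<in> carrier SU2"
  shows "R g ** B ** matrix_inv (R g) = B \<longleftrightarrow> R g ** B = B ** R g"
proof -
  have "matrix_inv (R g) = R (g\<^sup>\<dagger>)"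
    using R_dagger_inverse[OF assms] by (intro matrix_inv_eqI)
  then show ?thesis
    using R_dagger_inverse[OF assms] by (metis matrix_mul_assoc matrix_mul_rid)
qed

lemma stabilizer_eq_centralizer:
  assumes "\<And>g. g \<in> carrier SU2 \<Longrightarrow> act g B = R g ** B ** matrix_inv (R g)"
  shows "stabilizer SU2 act B = centralizer B"
proof -
  have "act g B = B \<longleftrightarrow> R g ** B = B ** R g" if "g \<in> carrier SU2" for g
    unfolding assms[OF that] by (rule conj_eq_iff[OF that])
  then show ?thesis by (auto simp: stabilizer_def centralizer_def)
qed

lemma binary_subgroup_centralizer: "binary_subgroup (centralizer B)"
proof
  show "centralizer B \<subseteq> carrier SU2" by (auto simp: centralizer_def)
next
  fix g h assume "g \<in> centralizer B" "h \<in> centralizer B"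
  then show "g ** h \<in> centralizer B"
    by (auto simp: centralizer_def R_mult SU2_mult) (metis matrix_mul_assoc)
next
  fix g assume g: "g \<in> centralizer B"
  then have SU2: "g \<in> carrier SU2" and c: "R g ** B = B ** R g" by (auto simp: centralizer_def)
  have "R (g\<^sup>\<dagger>) ** B = R (g\<^sup>\<dagger>) ** (B ** R g) ** R (g\<^sup>\<dagger>)"
    using SU2 by (simp add: matrix_mul_assoc[symmetric] R_dagger_inverse)
  also have "\<dots> = B ** R (g\<^sup>\<dagger>)"
    using SU2 by (simp add: c[symmetric] R_cancel)
  finally show "g\<^sup>\<dagger> \<in> centralizer B"
    using SU2 by (simp add: centralizer_def)
next
  have "- mat 1 \<in> carrier SU2" by simp
  moreover have "- mat 1 ** B = B ** - mat 1"
    by (simp add: vec_eq_iff matrix_matrix_mult_def mat_def if_distrib if_distribR cong: if_cong)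
  ultimately show "- mat 1 \<in> centralizer B"
    using R_minus_one by (auto simp: centralizer_def)
qed

lemma centralizer_conj:
  assumes s: "s \<in> carrier SU2" and g: "g \<in> centralizer B"
  shows "s\<^sup>\<dagger> ** g ** s \<in> centralizer (R (s\<^sup>\<dagger>) ** B ** R s)"
proof -
  have SU2: "g \<in> carrier SU2" and c: "R g ** B = B ** R g" using g by (auto simp: centralizer_def)
  have "R (s\<^sup>\<dagger> ** g ** s) ** (R (s\<^sup>\<dagger>) ** B ** R s) = R (s\<^sup>\<dagger>) ** (R g ** B) ** R s"
    using s SU2 by (simp add: R_mult SU2_mult matrix_mul_assoc[symmetric] R_cancel)
  also have "\<dots> = (R (s\<^sup>\<dagger>) ** B ** R s) ** R (s\<^sup>\<dagger> ** g ** s)"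
    using s SU2 unfolding c by (simp add: R_mult SU2_mult matrix_mul_assoc[symmetric] R_cancel)
  finally show ?thesis
    using s SU2 by (simp add: centralizer_def SU2_mult)
qed

text \<open>If every diagonal element with real part outside \<open>V\<close> drags the whole torus into the
  centralizer, then by conjugation any element with real part outside \<open>V\<close> makes the centralizer infinite.\<close>

lemma finite_centralizer_real_part:
  assumes torus: "\<And>B a y t. quat a y 0 0 \<in> centralizer B \<Longrightarrow> a \<notin> V \<Longrightarrow>
      quat (cos t) (sin t) 0 0 \<in> centralizer B"
    and fin: "finite (centralizer B)"
  shows "real_part ` centralizer B \<subseteq> V"
proof (rule ccontr)
  assume "\<not> ?thesis"
  then obtain g where g: "g \<in> centralizer B" "real_part g \<notin> V" by blast
  then have "g \<in> carrier SU2" by (simp add: centralizer_def)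
  then obtain s y where s: "s \<in> carrier SU2" "s\<^sup>\<dagger> ** g ** s = quat (real_part g) y 0 0"
    by (rule SU2_conj_diagonal)
  let ?B = "R (s\<^sup>\<dagger>) ** B ** R s"
  have "quat (real_part g) y 0 0 \<in> centralizer ?B"
    using centralizer_conj[OF s(1) g(1)] s(2) by simp
  then have t: "quat (cos t) (sin t) 0 0 \<in> centralizer ?B" for t
    using torus g(2) by blast
  \<comment> \<open>Conjugating back gives a circle in the centralizer of \<open>B\<close>; the half circle \<open>[0, \<pi>]\<close> is parametrised injectively.\<close>
  have "R s ** ?B ** R (s\<^sup>\<dagger>) = B"
    using s(1) by (simp add: matrix_mul_assoc[symmetric] R_cancel R_dagger_inverse)
  then have sub: "(\<lambda>t. (s\<^sup>\<dagger>)\<^sup>\<dagger> ** quat (cos t) (sin t) 0 0 ** s\<^sup>\<dagger>) ` {0..pi} \<subseteq> centralizer B"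
    using centralizer_conj[OF SU2_dagger[OF s(1)] t] by auto
  have "inj_on (\<lambda>t. quat (cos t) (sin t) 0 0) {0..pi}"
    by (auto simp: inj_on_def quat_eq_iff dest: cos_inj_pi)
  then have "inj_on ((\<lambda>h. (s\<^sup>\<dagger>)\<^sup>\<dagger> ** h ** s\<^sup>\<dagger>) \<circ> (\<lambda>t. quat (cos t) (sin t) 0 0)) {0..pi}"
    by (rule comp_inj_on) (rule inj_on_subset[OF SU2_conj_inj[OF SU2_dagger[OF s(1)]] subset_UNIV])
  then have "inj_on (\<lambda>t. (s\<^sup>\<dagger>)\<^sup>\<dagger> ** quat (cos t) (sin t) 0 0 ** s\<^sup>\<dagger>) {0..pi}"
    by (simp add: comp_def)
  then have "finite {0..pi}"
    using finite_subset[OF sub fin] by (rule finite_imageD[rotated])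
  then show False using infinite_Icc[OF pi_gt_zero] by contradiction
qed

end

section \<open>The three-dimensional representation\<close>

lemma cover_quat:
  "cover (quat a b c d) =
     vector [vector [a^2 - b^2 - c^2 + d^2, 2*a*b + 2*c*d, 2*b*d - 2*a*c],
             vector [2*c*d - 2*a*b, a^2 - b^2 + c^2 - d^2, 2*a*d + 2*b*c],
             vector [2*b*d + 2*a*c, 2*b*c - 2*a*d, a^2 + b^2 - c^2 - d^2]]"
  by (subst cover_entries[of _ a b "-c" d]) (simp_all add: quat_def complex_eq_iff)

interpretation R3: SU2_rep R3
proof
  fix g h :: "complex^2^2" assume "g \<in> carrier SU2" "h \<in> carrier SU2"
  then show "R3 (g ** h) = R3 g ** R3 h"
    using R3_hom by (auto simp: hom_def SU_def)
next
  show "R3 (mat 1) = mat 1"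
    unfolding R3_def quat_one cover_quat by (simp add: vec_eq_iff forall_3 mat_def)
  show "R3 (- mat 1) = mat 1 \<or> R3 (- mat 1) = - mat 1"
    unfolding R3_def quat_one quat_uminus cover_quat by (simp add: vec_eq_iff forall_3 mat_def)
qed

text \<open>A diagonal element acts by a rotation about the third axis. Unless the angle is a multiple of
  \<open>\<pi>\<close>, a matrix commuting with it is block diagonal with first block \<open>x + yT\<close>, \<open>T\<close> the quarter turn, and so
  commutes with all rotations about this axis.\<close>

lemma R3_torus:
  assumes g: "quat a y 0 0 \<in> R3.centralizer B" and a: "a \<notin> {0, 1, -1}"
  shows "quat (cos t) (sin t) 0 0 \<in> R3.centralizer B"
proof -
  have n: "a^2 + y^2 = 1" and comm: "R3 (quat a y 0 0) ** B = B ** R3 (quat a y 0 0)"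
    using g by (simp_all add: R3.centralizer_def)
  have y: "y \<noteq> 0" using n a by (auto simp: power2_eq_1_iff)
  define C S where "C = complex_of_real (a^2 - y^2)" and "S = complex_of_real (2 * a * y)"
  have S: "S \<noteq> 0" using a y by (simp add: S_def)
  have "(a^2 - y^2 - 1)^2 + (2 * a * y)^2 \<noteq> 0"
    using a y by (simp add: sum_power2_eq_zero_iff)
  moreover have "(C - 1) * (C - 1) + S * S = complex_of_real ((a^2 - y^2 - 1)^2 + (2 * a * y)^2)"
    by (simp add: C_def S_def power2_eq_square)
  ultimately have D: "(C - 1) * (C - 1) + S * S \<noteq> 0"
    by (simp only: of_real_eq_0_iff not_False_eq_True)
  have R: "R3 (quat a y 0 0) = vector [vector [C, S, 0], vector [- S, C, 0], vector [0, 0, 1]]"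
    using n by (simp add: R3_def cover_quat vec_eq_iff forall_3 C_def S_def)
  have E: "C * B$1$1 + S * B$2$1 = B$1$1 * C - B$1$2 * S" "C * B$1$2 + S * B$2$2 = B$1$1 * S + B$1$2 * C"
    "C * B$1$3 + S * B$2$3 = B$1$3" "C * B$2$3 - S * B$1$3 = B$2$3"
    "B$3$1 = B$3$1 * C - B$3$2 * S" "B$3$2 = B$3$1 * S + B$3$2 * C"
    using comm unfolding R
    by (simp_all add: vec_eq_iff forall_3 matrix_matrix_mult_def sum_3 algebra_simps)
  have kernel: "x = 0 \<and> y = 0" if "(C - 1) * x + S * y = 0" "(C - 1) * y - S * x = 0" for x y
  proof -
    have "((C - 1) * (C - 1) + S * S) * x = 0" using that by algebra
    moreover have "((C - 1) * (C - 1) + S * S) * y = 0" using that by algebra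
    ultimately show ?thesis using D by simp
  qed
  have z: "B$1$3 = 0" "B$2$3 = 0" "B$3$1 = 0" "B$3$2 = 0"
    using kernel[of "B$1$3" "B$2$3"] kernel[of "B$3$2" "B$3$1"] E(3-6)
    by (simp_all add: algebra_simps)
  have "S * (B$2$1 + B$1$2) = 0" using E(1) by algebra
  moreover have "S * (B$2$2 - B$1$1) = 0" using E(2) by algebra
  ultimately have b: "B$2$1 = - B$1$2" "B$2$2 = B$1$1"
    using S by (auto simp: eq_neg_iff_add_eq_0)
  have "R3 (quat (cos t) (sin t) 0 0) ** B = B ** R3 (quat (cos t) (sin t) 0 0)"
    by (simp add: R3_def cover_quat vec_eq_iff forall_3 matrix_matrix_mult_def sum_3 z b algebra_simps)
  then show ?thesis by (simp add: R3.centralizer_def)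
qed

text \<open>Distinct eigenvalues along the coordinate axes leave only the diagonal rotations as symmetries.\<close>

definition witness3 :: "complex^3^3"
  where "witness3 = vector [vector [1, 0, 0], vector [0, \<i>, 0], vector [0, 0, -\<i>]]"

lemma witness3_in_SU3: "witness3 \<in> carrier SU3"
  by (simp add: SU_def unitary_matrix_def witness3_def det_3 vec_eq_iff forall_3
      matrix_matrix_mult_def sum_3 conj_transpose_def transpose_def mat_def)

lemma centralizer_witness3: "R3.centralizer witness3 = Q4"
proof
  show "Q4 \<subseteq> R3.centralizer witness3"
    unfolding Q4_quat
    by (simp add: R3.centralizer_def R3_def cover_quat witness3_def vec_eq_iff forall_3
        matrix_matrix_mult_def sum_3)
  show "R3.centralizer witness3 \<subseteq> Q4"
  proof
    fix g assume g: "g \<in> R3.centralizer witness3"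
    then have "g \<in> carrier SU2" by (simp add: R3.centralizer_def)
    then obtain a b c d where q: "g = quat a b c d" and n: "a^2 + b^2 + c^2 + d^2 = 1"
      by (rule SU2_quatE)
    have comm: "R3 g ** witness3 = witness3 ** R3 g" using g by (simp add: R3.centralizer_def)
    have "cover g $ i $ j = 0" if "i \<noteq> j" for i j
    proof -
      have "complex_of_real (cover g $ i $ j) * witness3 $ j $ j = witness3 $ i $ i * complex_of_real (cover g $ i $ j)"
        using comm exhaust_3[of i] exhaust_3[of j] that
        by (auto simp: R3_def witness3_def vec_eq_iff forall_3 matrix_matrix_mult_def sum_3 complex_eq_iff)
      moreover have "witness3 $ i $ i \<noteq> witness3 $ j $ j"
        using that exhaust_3[of i] exhaust_3[of j] by (auto simp: witness3_def complex_eq_iff)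
      ultimately show ?thesis by (metis mult.commute mult_cancel_left of_real_eq_0_iff)
    qed
    from this[of 1 2] this[of 2 1] this[of 1 3] this[of 3 1] this[of 2 3] this[of 3 2]
    have "2*a*b + 2*c*d = 0" "2*c*d - 2*a*b = 0" "2*b*d - 2*a*c = 0" "2*b*d + 2*a*c = 0"
      "2*a*d + 2*b*c = 0" "2*b*c - 2*a*d = 0"
      by (simp_all add: q cover_quat)
    then have "a * b = 0" "c * d = 0" "a * c = 0" "b * d = 0" "a * d = 0" "b * c = 0"
      by linarith+
    then have "1 \<in> {a^2, b^2, c^2, d^2}" using n by auto
    then show "g \<in> Q4" using quat_in_Q4[OF n] q by simp
  qed
qed

section \<open>The four-dimensional representation\<close>

text \<open>The weights of the third symmetric power, in the order of the basis used by \<open>cube\<close>.\<close>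

definition cubic_weights :: "complex \<Rightarrow> complex \<Rightarrow> 4 \<Rightarrow> complex"
  where "cubic_weights z w k =
    (if k = 1 then z^3 else if k = 2 then z^2 * w else if k = 3 then w^3 else z * w^2)"

lemma R4_diagonal:
  "R4 (vector [vector [z, 0], vector [0, w]]) = (\<chi> i j. if i = j then cubic_weights z w i else 0)"
  by (simp add: R4_eq R4mat_def Let_def vec_eq_iff forall_4 cubic_weights_def)

lemma inj_cubic_weights:
  assumes z: "z \<noteq> 0" "w \<noteq> 0" and ne: "z \<noteq> w" "z \<noteq> - w" and ne3: "z^2 + z * w + w^2 \<noteq> 0"
  shows "inj (cubic_weights z w)"
proof -
  have "z^3 - z^2 * w = z^2 * (z - w)"
    "z^3 - w^3 = (z - w) * (z^2 + z * w + w^2)"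
    "z^3 - z * w^2 = z * (z - w) * (z + w)"
    "z^2 * w - w^3 = w * (z - w) * (z + w)"
    "z^2 * w - z * w^2 = z * w * (z - w)"
    "w^3 - z * w^2 = w^2 * (w - z)"
    by (simp_all add: power2_eq_square power3_eq_cube algebra_simps)
  moreover have "z + w \<noteq> 0" using ne by (simp add: eq_neg_iff_add_eq_0)
  ultimately have "z^3 - z^2 * w \<noteq> 0" "z^3 - w^3 \<noteq> 0" "z^3 - z * w^2 \<noteq> 0"
    "z^2 * w - w^3 \<noteq> 0" "z^2 * w - z * w^2 \<noteq> 0" "w^3 - z * w^2 \<noteq> 0"
    using assms by simp_all
  then have "z^3 \<noteq> z^2 * w" "z^3 \<noteq> w^3" "z^3 \<noteq> z * w^2"
    "z^2 * w \<noteq> w^3" "z^2 * w \<noteq> z * w^2" "w^3 \<noteq> z * w^2"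
    by (metis right_minus_eq)+
  then have "cubic_weights z w i \<noteq> cubic_weights z w j" if "i \<noteq> j" for i j
    using that exhaust_4[of i] exhaust_4[of j] unfolding cubic_weights_def
    by (elim disjE; simp)
  then show ?thesis by (meson injI)
qed

lemma commute_diagonal_iff:
  fixes B :: "'a::field^'n^'n"
  shows "(\<chi> i j. if i = j then e i else 0) ** B = B ** (\<chi> i j. if i = j then e i else 0)
    \<longleftrightarrow> (\<forall>i j. e i = e j \<or> B$i$j = 0)"
proof -
  have "((\<chi> i j. if i = j then e i else 0) ** B) $ i $ j = e i * B $ i $ j"
    "(B ** (\<chi> i j. if i = j then e i else 0)) $ i $ j = e j * B $ i $ j" for i j
    by (simp_all add: matrix_matrix_mult_def if_distrib if_distribR mult.commute cong: if_cong)
  then show ?thesis by (auto simp: vec_eq_iff)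
qed

interpretation R4: SU2_rep R4
proof
  have eq: "- mat 1 = (vector [vector [-1, 0], vector [0, -1]] :: complex^2^2)"
    by (simp add: vec_eq_iff forall_2 mat_def)
  show "R4 (- mat 1) = mat 1 \<or> R4 (- mat 1) = - mat 1"
    unfolding eq R4_diagonal by (simp add: vec_eq_iff mat_def cubic_weights_def)
qed (simp_all add: R4_mult R4_one)

text \<open>Two of the weights \<open>\<plusminus>\<theta>, \<plusminus>3\<theta>\<close> coincide modulo \<open>2\<pi>\<close> only if \<open>cos \<theta>\<close> is one of the excluded values. Otherwise
  \<open>B\<close> is diagonal.\<close>

lemma R4_torus:
  assumes g: "quat a y 0 0 \<in> R4.centralizer B" and a: "a \<notin> {0, 1/2, -1/2, 1, -1}"
  shows "quat (cos t) (sin t) 0 0 \<in> R4.centralizer B"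
proof -
  have R: "R4 (quat p q 0 0) =
      (\<chi> i j. if i = j then cubic_weights (Complex p q) (Complex p (-q)) i else 0)" for p q
  proof -
    have "quat p q 0 0 = vector [vector [Complex p q, 0], vector [0, Complex p (-q)]]"
      by (simp add: quat_def vec_eq_iff forall_2 complex_eq_iff)
    then show ?thesis by (simp only: R4_diagonal)
  qed
  have n: "a^2 + y^2 = 1" and comm: "R4 (quat a y 0 0) ** B = B ** R4 (quat a y 0 0)"
    using g by (simp_all add: R4.centralizer_def)
  have y: "y \<noteq> 0" and a0: "a \<noteq> 0" using n a by (auto simp: power2_eq_1_iff)
  have "a^2 \<noteq> 1/4" using a unfolding sq_quarter by simp
  then have y3: "3 * a^2 - y^2 \<noteq> 0" using n by linarith
  have "Re ((Complex a y)^2 + Complex a y * Complex a (-y) + (Complex a (-y))^2) = 3 * a^2 - y^2"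
    by (simp add: power2_eq_square)
  then have "(Complex a y)^2 + Complex a y * Complex a (-y) + (Complex a (-y))^2 \<noteq> 0"
    using y3 by (metis zero_complex.sel(1))
  then have inj: "inj (cubic_weights (Complex a y) (Complex a (-y)))"
    using y a0 by (intro inj_cubic_weights) (simp_all add: complex_eq_iff)
  have "\<forall>i j. cubic_weights (Complex a y) (Complex a (-y)) i = cubic_weights (Complex a y) (Complex a (-y)) j
      \<or> B$i$j = 0"
    using comm by (simp only: R commute_diagonal_iff simp_thms)
  then have diag: "i = j \<or> B$i$j = 0" for i j
    unfolding inj_eq[OF inj] by blast
  have "R4 (quat (cos t) (sin t) 0 0) ** B = B ** R4 (quat (cos t) (sin t) 0 0)"
    unfolding R commute_diagonal_iff using diag by metis
  then show ?thesis by (simp add: R4.centralizer_def)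
qed

text \<open>Up to a scalar this is the symmetrised product of the three infinitesimal generators
  of \<open>R4\<close>, the operator analogue of the cubic form \<open>xyz\<close>. The rotations that preserve \<open>xyz\<close> are those of the
  tetrahedron.\<close>

definition witness4 :: "complex^4^4"
  where "witness4 = (\<chi> i j. if (i, j) \<in> {(1, 4), (2, 3)} then 1
                            else if (i, j) \<in> {(4, 1), (3, 2)} then -1 else 0)"

lemma witness4_in_Sp4: "witness4 \<in> carrier Sp4"
  by (simp add: Sp4_def unitary_matrix_def witness4_def symplectic_J_def vec_eq_iff forall_4
      matrix_matrix_mult_def sum_4 conj_transpose_def transpose_def mat_def)

lemma commute_witness4_iff:
  "M ** witness4 = witness4 ** M \<longleftrightarrow>
    M$4$1 = - M$1$4 \<and> M$4$2 = - M$1$3 \<and> M$4$3 = M$1$2 \<and> M$4$4 = M$1$1 \<and>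
    M$3$1 = - M$2$4 \<and> M$3$2 = - M$2$3 \<and> M$3$3 = M$2$2 \<and> M$3$4 = M$2$1"
  by (simp add: witness4_def vec_eq_iff forall_4 matrix_matrix_mult_def sum_4) metis

text \<open>The commutation relation entry by entry, with the factors \<open>sqrt 3\<close> cancelled.\<close>

lemma R4_commute_witness4_iff:
  fixes g :: "complex^2^2"
  defines "p \<equiv> g$1$1" and "q \<equiv> g$1$2" and "u \<equiv> g$2$1" and "v \<equiv> g$2$2"
  shows "R4 g ** witness4 = witness4 ** R4 g \<longleftrightarrow>
    p * (q^2 + u^2) = 0 \<and> v * (q^2 + u^2) = 0 \<and> q * (p^2 + v^2) = 0 \<and> u * (p^2 + v^2) = 0 \<and>
    p^3 = p * v^2 + 2 * q * u * v \<and> v^3 = p^2 * v + 2 * p * q * u \<and>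
    q^3 = 2 * p * u * v + q * u^2 \<and> u^3 = 2 * p * q * v + q^2 * u"
proof -
  define s where "s = complex_of_real (sqrt 3)"
  have s: "s \<noteq> 0" by (simp add: s_def)
  have "R4 g ** witness4 = witness4 ** R4 g \<longleftrightarrow>
    - s * p * u^2 = - (- s * p * q^2) \<and> - (2 * p * u * v + q * u^2) = - (q^3) \<and>
    - s * q * v^2 = s * p^2 * q \<and> p * v^2 + 2 * q * u * v = p^3 \<and>
    u^3 = - (- (2 * p * q * v + q^2 * u)) \<and> s * u^2 * v = - (s * q^2 * v) \<and>
    v^3 = p^2 * v + 2 * p * q * u \<and> - s * u * v^2 = s * p^2 * u"
    unfolding commute_witness4_iff R4_eq R4mat_def Let_def p_def q_def u_def v_def s_def by simp
  moreover have "- s * p * u^2 = - (- s * p * q^2) \<longleftrightarrow> p * (q^2 + u^2) = 0"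
  proof -
    have "- s * p * u^2 = - (- s * p * q^2) \<longleftrightarrow> s * (p * (q^2 + u^2)) = 0" by algebra
    then show ?thesis using s by simp
  qed
  moreover have "- s * q * v^2 = s * p^2 * q \<longleftrightarrow> q * (p^2 + v^2) = 0"
  proof -
    have "- s * q * v^2 = s * p^2 * q \<longleftrightarrow> s * (q * (p^2 + v^2)) = 0" by algebra
    then show ?thesis using s by simp
  qed
  moreover have "s * u^2 * v = - (s * q^2 * v) \<longleftrightarrow> v * (q^2 + u^2) = 0"
  proof -
    have "s * u^2 * v = - (s * q^2 * v) \<longleftrightarrow> s * (v * (q^2 + u^2)) = 0" by algebra
    then show ?thesis using s by simp
  qed
  moreover have "- s * u * v^2 = s * p^2 * u \<longleftrightarrow> u * (p^2 + v^2) = 0"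
  proof -
    have "- s * u * v^2 = s * p^2 * u \<longleftrightarrow> s * (u * (p^2 + v^2)) = 0" by algebra
    then show ?thesis using s by simp
  qed
  moreover have "- (2 * p * u * v + q * u^2) = - (q^3) \<longleftrightarrow> q^3 = 2 * p * u * v + q * u^2"
    by (metis minus_minus)
  moreover have
    "p * v^2 + 2 * q * u * v = p^3 \<longleftrightarrow> p^3 = p * v^2 + 2 * q * u * v"
    "u^3 = - (- (2 * p * q * v + q^2 * u)) \<longleftrightarrow> u^3 = 2 * p * q * v + q^2 * u"
    by auto
  ultimately show ?thesis by blast
qed

lemma quat_entries:
  "quat a b c d $ 1 $ 1 = Complex a b" "quat a b c d $ 1 $ 2 = Complex c d"
  "quat a b c d $ 2 $ 1 = Complex (-c) d" "quat a b c d $ 2 $ 2 = Complex a (-b)"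
  by (simp_all add: quat_def)

text \<open>If an entry of \<open>g\<close> vanishes, the cubic equations leave only the elements of \<open>Q4\<close>. If none
  does, the quadratic equations give \<open>a\<^sup>2 = b\<^sup>2\<close> and \<open>c\<^sup>2 = d\<^sup>2\<close>, and a cubic one makes all four equal.\<close>

lemma centralizer_witness4: "R4.centralizer witness4 = hurwitz_units"
proof
  show "R4.centralizer witness4 \<subseteq> hurwitz_units"
  proof
    fix g assume g: "g \<in> R4.centralizer witness4"
    then have "g \<in> carrier SU2" by (simp add: R4.centralizer_def)
    then obtain a b c d where q: "g = quat a b c d" and n: "a^2 + b^2 + c^2 + d^2 = 1"
      by (rule SU2_quatE)
    have "R4 g ** witness4 = witness4 ** R4 g" using g by (simp add: R4.centralizer_def)
    note E = this[unfolded R4_commute_witness4_iff q quat_entries]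
    have pq: "Complex a b * ((Complex c d)^2 + (Complex (-c) d)^2) = 0"
      "Complex c d * ((Complex a b)^2 + (Complex a (-b))^2) = 0"
      and cubic: "(Complex a b)^3 = Complex a b * (Complex a (-b))^2 + 2 * Complex c d * Complex (-c) d * Complex a (-b)"
      "(Complex c d)^3 = 2 * Complex a b * Complex (-c) d * Complex a (-b) + Complex c d * (Complex (-c) d)^2"
      using E by blast+
    consider "a = 0" "b = 0" | "c = 0" "d = 0" | "a \<noteq> 0 \<or> b \<noteq> 0" "c \<noteq> 0 \<or> d \<noteq> 0" by blast
    then show "g \<in> hurwitz_units"
    proof cases
      case 1
      then have "c^2 * d = 0" "c * d^2 = 0"
        using cubic(2) by (simp_all add: complex_eq_iff power2_eq_square power3_eq_cube algebra_simps)
      then have "1 \<in> {a^2, b^2, c^2, d^2}" using n 1 by auto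
      then show ?thesis using quat_in_Q4[OF n] by (simp add: q hurwitz_units_def)
    next
      case 2
      then have "a^2 * b = 0" "a * b^2 = 0"
        using cubic(1) by (simp_all add: complex_eq_iff power2_eq_square power3_eq_cube algebra_simps)
      then have "1 \<in> {a^2, b^2, c^2, d^2}" using n 2 by auto
      then show ?thesis using quat_in_Q4[OF n] by (simp add: q hurwitz_units_def)
    next
      case 3
      then have nz: "Complex a b \<noteq> 0" "Complex c d \<noteq> 0" by (auto simp: complex_eq_iff)
      have "(Complex c d)^2 + (Complex (-c) d)^2 = 0" "(Complex a b)^2 + (Complex a (-b))^2 = 0"
        using pq nz by simp_all
      then have cd: "d^2 = c^2" and ab: "b^2 = a^2"
        by (simp_all add: complex_eq_iff power2_eq_square)
      then have a0: "a \<noteq> 0" using 3 by auto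
      have "2 * a * (2 * b^2 - (c^2 + d^2)) = 0"
        using arg_cong[OF cubic(1), of Re]
        by (simp add: power2_eq_square power3_eq_cube algebra_simps)
      then have "2 * b^2 = c^2 + d^2" using a0 by simp
      then have "a^2 = 1/4 \<and> b^2 = 1/4 \<and> c^2 = 1/4 \<and> d^2 = 1/4"
        using n ab cd by simp
      then show ?thesis unfolding q hurwitz_units_def by blast
    qed
  qed
  have "quat a b c d \<in> R4.centralizer witness4"
    if sq: "a^2 = 1/4" "b^2 = 1/4" "c^2 = 1/4" "d^2 = 1/4" for a b c d
  proof -
    have m: "a * a = 1/4" "b * b = 1/4" "c * c = 1/4" "d * d = 1/4"
      using sq by (simp_all add: power2_eq_square)
    have m': "a * (a * x) = x/4" "b * (b * x) = x/4" "c * (c * x) = x/4" "d * (d * x) = x/4" for x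
      by (simp_all add: m flip: mult.assoc)
    show ?thesis
      unfolding R4.centralizer_def mem_Collect_eq R4_commute_witness4_iff quat_entries
      by (simp add: sq) (simp add: complex_eq_iff power2_eq_square power3_eq_cube algebra_simps m m')
  qed
  moreover have "Q4 \<subseteq> R4.centralizer witness4"
    unfolding Q4_quat insert_subset R4.centralizer_def mem_Collect_eq R4_commute_witness4_iff quat_entries
    by (simp add: complex_eq_iff power2_eq_square power3_eq_cube)
  ultimately show "hurwitz_units \<subseteq> R4.centralizer witness4"
    unfolding hurwitz_units_def by blast
qed

section \<open>The binary tetrahedral group consists of the Hurwitz units\<close>

lemma tetrahedron_component:
  assumes "v \<in> tetrahedron"
  shows "v$i = 1 \<or> v$i = -1" "v$1 * v$2 * v$3 = 1"
  using assms exhaust_3[of i] by (auto simp: tetrahedron_def)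

lemma hurwitz_units_subset_BA4: "hurwitz_units \<subseteq> BA4"
proof
  fix g assume g: "g \<in> hurwitz_units"
  have mem: "g \<in> BA4" if SU2: "g \<in> carrier SU2" and maps: "\<forall>v \<in> tetrahedron. cover g *v v \<in> tetrahedron"
  proof -
    have rot: "rotation_matrix (cover g)" by (rule cover_rotation[OF SU2])
    then have "transpose (cover g) ** cover g = mat 1"
      by (simp add: rotation_matrix_def orthogonal_matrix)
    then have "inj_on ((*v) (cover g)) tetrahedron"
      by (intro inj_on_inverseI[of _ "(*v) (transpose (cover g))"])
        (simp add: matrix_vector_mul_assoc)
    moreover have "finite tetrahedron" by (simp add: tetrahedron_def)
    moreover have "(*v) (cover g) ` tetrahedron \<subseteq> tetrahedron" using maps by blast
    ultimately have "(*v) (cover g) ` tetrahedron = tetrahedron"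
      by (intro endo_inj_surj)
    then show ?thesis using SU2 rot by (simp add: BA4_def tetrahedral_rotations_def)
  qed
  from g consider "g \<in> Q4" | a b c d where "g = quat a b c d" "a^2 = 1/4" "b^2 = 1/4" "c^2 = 1/4" "d^2 = 1/4"
    unfolding hurwitz_units_def by blast
  then show "g \<in> BA4"
  proof cases
    case 1
    have "\<forall>g \<in> Q4. g \<in> carrier SU2 \<and> (\<forall>v \<in> tetrahedron. cover g *v v \<in> tetrahedron)"
      unfolding Q4_quat
      by (simp add: cover_quat tetrahedron_def vec_eq_iff forall_3 matrix_vector_mult_def sum_3)
    then show ?thesis using mem 1 by blast
  next
    case 2
    have "\<forall>v \<in> tetrahedron. cover g *v v \<in> tetrahedron"
      using 2(2-5) unfolding 2(1) sq_quarter
      by (elim disjE; simp only:; simp add: cover_quat tetrahedron_def vec_eq_iff forall_3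
          matrix_vector_mult_def sum_3 power_divide)
    moreover have "g \<in> carrier SU2" using 2 by simp
    ultimately show ?thesis using mem by blast
  qed
qed

text \<open>The squares of the quaternion coordinates of a rotation are affine in its diagonal entries
  \<open>x, y, z\<close>. Nonnegativity of the squares rules out exactly two nonzero entries; exactly one nonzero entry gives the
  mixed cases, which are the quarter turns about coordinate axes and the half turns about diagonals of
  coordinate planes.\<close>

lemma squares_of_sign_diagonal:
  fixes a b c d x y z :: real
  assumes sign: "x \<in> {0, 1, -1}" "y \<in> {0, 1, -1}" "z \<in> {0, 1, -1}"
    and sq: "4 * a^2 = 1 + x + y + z" "4 * d^2 = 1 + x - y - z"
      "4 * c^2 = 1 - x + y - z" "4 * b^2 = 1 - x - y + z"
  shows "{a^2, b^2, c^2, d^2} \<subseteq> {0, 1/4, 1} \<or>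
      a^2 = 1/2 \<and> b^2 = 1/2 \<and> c = 0 \<and> d = 0 \<or> a^2 = 1/2 \<and> c^2 = 1/2 \<and> b = 0 \<and> d = 0 \<or>
      a^2 = 1/2 \<and> d^2 = 1/2 \<and> b = 0 \<and> c = 0 \<or> b^2 = 1/2 \<and> c^2 = 1/2 \<and> a = 0 \<and> d = 0 \<or>
      b^2 = 1/2 \<and> d^2 = 1/2 \<and> a = 0 \<and> c = 0 \<or> c^2 = 1/2 \<and> d^2 = 1/2 \<and> a = 0 \<and> b = 0"
proof -
  obtain p q r s where pqrs: "p = a^2" "q = b^2" "r = c^2" "s = d^2" by blast
  then have zero: "a = 0 \<longleftrightarrow> p = 0" "b = 0 \<longleftrightarrow> q = 0" "c = 0 \<longleftrightarrow> r = 0" "d = 0 \<longleftrightarrow> s = 0"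
    by simp_all
  have nonneg: "p \<ge> 0" "q \<ge> 0" "r \<ge> 0" "s \<ge> 0" using pqrs by simp_all
  have e: "p = (1 + x + y + z)/4" "s = (1 + x - y - z)/4" "r = (1 - x + y - z)/4"
    "q = (1 - x - y + z)/4"
    using sq pqrs by simp_all
  show ?thesis
    unfolding pqrs[symmetric] zero
    using sign nonneg unfolding e by (elim insertE emptyE; simp only:; simp)
qed

text \<open>A vertex has entries \<open>\<plusminus>1\<close> and the sum of two distinct vertices is \<open>\<plusminus>2\<close> times a basis vector, so the
  diagonal entries of a tetrahedral rotation are \<open>0\<close> or \<open>\<plusminus>1\<close>. The mixed cases of
  \<open>squares_of_sign_diagonal\<close> are symmetries of the cube that send \<open>(1, 1, 1)\<close> to a point with product of
  coordinates \<open>-1\<close>, hence not to a vertex.\<close>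

lemma BA4_subset_hurwitz_units: "BA4 \<subseteq> hurwitz_units"
proof
  fix g assume "g \<in> BA4"
  then have SU2: "g \<in> carrier SU2" and im: "(*v) (cover g) ` tetrahedron = tetrahedron"
    by (auto simp: BA4_def tetrahedral_rotations_def)
  obtain a b c d where q: "g = quat a b c d" and n: "a^2 + b^2 + c^2 + d^2 = 1"
    using SU2 by (rule SU2_quatE)
  define A where "A = cover g"
  have T: "A *v v \<in> tetrahedron" if "v \<in> tetrahedron" for v
    using im that unfolding A_def by blast
  have vs: "vector [1, 1, 1] \<in> tetrahedron" "vector [1, -1, -1] \<in> tetrahedron"
    "vector [-1, 1, -1] \<in> tetrahedron" "vector [-1, -1, 1] \<in> tetrahedron"
    by (simp_all add: tetrahedron_def)
  have A: "A$1$1 = a^2 - b^2 - c^2 + d^2" "A$2$2 = a^2 - b^2 + c^2 - d^2" "A$3$3 = a^2 + b^2 - c^2 - d^2"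
    by (simp_all add: A_def q cover_quat)
  have sums: "(A *v vector [x, y, z]) $ i = A$i$1 * x + A$i$2 * y + A$i$3 * z" for x y z i
    by (simp add: matrix_vector_mult_def sum_3)
  have sg: "(A *v v) $ i = 1 \<or> (A *v v) $ i = -1" if "v \<in> tetrahedron" for v i
    using tetrahedron_component(1)[OF T[OF that]] .
  have diag: "A$1$1 \<in> {0, 1, -1}" "A$2$2 \<in> {0, 1, -1}" "A$3$3 \<in> {0, 1, -1}"
    using sg[OF vs(1), of 1] sg[OF vs(2), of 1] sg[OF vs(1), of 2] sg[OF vs(3), of 2]
      sg[OF vs(1), of 3] sg[OF vs(4), of 3]
    unfolding sums by auto
  have "(A *v vector [1, 1, 1]) $ 1 * (A *v vector [1, 1, 1]) $ 2 * (A *v vector [1, 1, 1]) $ 3 = 1"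
    using tetrahedron_component(2)[OF T[OF vs(1)]] .
  then have prod: "(a^2 - b^2 - c^2 + d^2 + (2*a*b + 2*c*d) + (2*b*d - 2*a*c)) *
      (2*c*d - 2*a*b + (a^2 - b^2 + c^2 - d^2) + (2*a*d + 2*b*c)) *
      (2*b*d + 2*a*c + (2*b*c - 2*a*d) + (a^2 + b^2 - c^2 - d^2)) = 1"
    unfolding sums by (simp add: A_def q cover_quat)
  have "4 * a^2 = 1 + A$1$1 + A$2$2 + A$3$3" "4 * d^2 = 1 + A$1$1 - A$2$2 - A$3$3"
    "4 * c^2 = 1 - A$1$1 + A$2$2 - A$3$3" "4 * b^2 = 1 - A$1$1 - A$2$2 + A$3$3"
    using n A by simp_all
  from squares_of_sign_diagonal[OF diag this] show "g \<in> hurwitz_units"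
  proof (elim disjE conjE)
    assume "{a^2, b^2, c^2, d^2} \<subseteq> {0, 1/4, 1}"
    then show ?thesis unfolding q by (rule quat_in_hurwitz_units[OF n])
  next
    assume "a^2 = 1/2" "b^2 = 1/2" "c = 0" "d = 0"
    then have "(2::real) = 0" using prod by algebra
    then show ?thesis by simp
  next
    assume "a^2 = 1/2" "c^2 = 1/2" "b = 0" "d = 0"
    then have "(2::real) = 0" using prod by algebra
    then show ?thesis by simp
  next
    assume "a^2 = 1/2" "d^2 = 1/2" "b = 0" "c = 0"
    then have "(2::real) = 0" using prod by algebra
    then show ?thesis by simp
  next
    assume "b^2 = 1/2" "c^2 = 1/2" "a = 0" "d = 0"
    then have "(2::real) = 0" using prod by algebra
    then show ?thesis by simp
  next
    assume "b^2 = 1/2" "d^2 = 1/2" "a = 0" "c = 0"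
    then have "(2::real) = 0" using prod by algebra
    then show ?thesis by simp
  next
    assume "c^2 = 1/2" "d^2 = 1/2" "a = 0" "b = 0"
    then have "(2::real) = 0" using prod by algebra
    then show ?thesis by simp
  qed
qed

lemma BA4_eq_hurwitz_units: "BA4 = hurwitz_units"
  using BA4_subset_hurwitz_units hurwitz_units_subset_BA4 by blast

section \<open>The largest finite stabilisers\<close>

text \<open>A stabiliser of maximal order cannot have order less than \<open>card K\<close>, so it is conjugate into \<open>K\<close> and,
  having the same order, conjugate onto \<open>K\<close>.\<close>

lemma largest_finite_stabilizer_unique:
  assumes x: "x \<in> E" "stabilizer SU2 act x = K" "finite K"
    and max: "\<And>y. y \<in> E \<Longrightarrow> finite (stabilizer SU2 act y) \<Longrightarrow>
      card (stabilizer SU2 act y) < card K \<or>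
      (\<exists>s \<in> carrier SU2. (\<lambda>g. s\<^sup>\<dagger> ** g ** s) ` stabilizer SU2 act y \<subseteq> K)"
  shows "(\<exists>H. largest_finite_stabilizer SU2 E act H) \<and>
    (\<forall>H. largest_finite_stabilizer SU2 E act H \<longrightarrow>
      card H = card K \<and> SU2\<lparr>carrier := H\<rparr> \<cong> SU2\<lparr>carrier := K\<rparr>)"
proof -
  have card_conj: "card ((\<lambda>g. s\<^sup>\<dagger> ** g ** s) ` H) = card H" if "s \<in> carrier SU2" for s H
    using inj_on_subset[OF SU2_conj_inj[OF that] subset_UNIV] by (rule card_image)
  have le: "card (stabilizer SU2 act y) \<le> card K"
    if "y \<in> E" "finite (stabilizer SU2 act y)" for y
    using max[OF that] card_mono[OF x(3)] card_conj by (metis less_imp_le)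
  then have "largest_finite_stabilizer SU2 E act K"
    using x unfolding largest_finite_stabilizer_def by blast
  moreover have "card H = card K \<and> SU2\<lparr>carrier := H\<rparr> \<cong> SU2\<lparr>carrier := K\<rparr>"
    if H: "largest_finite_stabilizer SU2 E act H" for H
  proof -
    from H obtain y where y: "y \<in> E" "H = stabilizer SU2 act y" "finite H"
      unfolding largest_finite_stabilizer_def by blast
    have "card K \<le> card H"
      using H x unfolding largest_finite_stabilizer_def by blast
    then have eq: "card H = card K" using le y by force
    then obtain s where s: "s \<in> carrier SU2" "(\<lambda>g. s\<^sup>\<dagger> ** g ** s) ` H \<subseteq> K"
      using max y by force
    have "(\<lambda>g. s\<^sup>\<dagger> ** g ** s) ` H = K"
      using card_subset_eq[OF x(3) s(2)] card_conj[OF s(1)] eq by simp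
    then show ?thesis using SU2_conj_is_iso[OF s(1)] eq by blast
  qed
  ultimately show ?thesis by blast
qed

lemma stabilizer_act3: "B \<in> carrier SU3 \<Longrightarrow> stabilizer SU2 act3 B = R3.centralizer B"
  by (rule R3.stabilizer_eq_centralizer) (simp add: act3_def)

lemma stabilizer_act4: "B \<in> carrier Sp4 \<Longrightarrow> stabilizer SU2 act4 B = R4.centralizer B"
  by (rule R4.stabilizer_eq_centralizer) (simp add: act4_def)

theorem mainTheorem1:
  shows "(\<exists>H. largest_finite_stabilizer SU2 (carrier SU3) act3 H) \<and>
         (\<forall>H. largest_finite_stabilizer SU2 (carrier SU3) act3 H \<longrightarrow>
              card H = 8 \<and> SU2\<lparr>carrier := H\<rparr> \<cong> SU2\<lparr>carrier := Q4\<rparr>) \<and>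
         (\<exists>H. largest_finite_stabilizer SU2 (carrier Sp4) act4 H) \<and>
         (\<forall>H. largest_finite_stabilizer SU2 (carrier Sp4) act4 H \<longrightarrow>
              card H = 24 \<and> SU2\<lparr>carrier := H\<rparr> \<cong> SU2\<lparr>carrier := BA4\<rparr>)"
proof -
  have 3: "card (stabilizer SU2 act3 B) < card Q4 \<or>
      (\<exists>s \<in> carrier SU2. (\<lambda>g. s\<^sup>\<dagger> ** g ** s) ` stabilizer SU2 act3 B \<subseteq> Q4)"
    if B: "B \<in> carrier SU3" and fin: "finite (stabilizer SU2 act3 B)" for B
  proof -
    have fin: "finite (R3.centralizer B)" using B fin by (simp add: stabilizer_act3)
    have "real_part ` R3.centralizer B \<subseteq> {0, 1, -1}"
      using R3_torus fin by (rule R3.finite_centralizer_real_part)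
    then have "card (R3.centralizer B) \<le> 4 \<or>
        (\<exists>s \<in> carrier SU2. (\<lambda>g. s\<^sup>\<dagger> ** g ** s) ` R3.centralizer B \<subseteq> Q4)"
      by (rule binary_subgroup.conj_into_Q4[OF R3.binary_subgroup_centralizer fin])
    then show ?thesis unfolding stabilizer_act3[OF B] card_Q4 by auto
  qed
  have 4: "card (stabilizer SU2 act4 B) < card BA4 \<or>
      (\<exists>s \<in> carrier SU2. (\<lambda>g. s\<^sup>\<dagger> ** g ** s) ` stabilizer SU2 act4 B \<subseteq> BA4)"
    if B: "B \<in> carrier Sp4" and fin: "finite (stabilizer SU2 act4 B)" for B
  proof -
    have fin: "finite (R4.centralizer B)" using B fin by (simp add: stabilizer_act4)
    have "real_part ` R4.centralizer B \<subseteq> {0, 1/2, -1/2, 1, -1}"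
      using R4_torus fin by (rule R4.finite_centralizer_real_part)
    then have "card (R4.centralizer B) \<le> 12 \<or>
        (\<exists>s \<in> carrier SU2. (\<lambda>g. s\<^sup>\<dagger> ** g ** s) ` R4.centralizer B \<subseteq> hurwitz_units)"
      by (rule binary_subgroup.conj_into_hurwitz_units[OF R4.binary_subgroup_centralizer fin])
    then show ?thesis
      unfolding stabilizer_act4[OF B] BA4_eq_hurwitz_units card_hurwitz_units by auto
  qed
  have "stabilizer SU2 act3 witness3 = Q4"
    by (simp add: stabilizer_act3 witness3_in_SU3 centralizer_witness3)
  note SU3 = largest_finite_stabilizer_unique[OF witness3_in_SU3 this finite_Q4 3, unfolded card_Q4]
  have "stabilizer SU2 act4 witness4 = BA4"
    by (simp add: stabilizer_act4 witness4_in_Sp4 centralizer_witness4 BA4_eq_hurwitz_units)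
  moreover have "finite BA4" "card BA4 = 24"
    by (simp_all add: BA4_eq_hurwitz_units finite_hurwitz_units card_hurwitz_units)
  ultimately show ?thesis
    using SU3 largest_finite_stabilizer_unique[OF witness4_in_Sp4 _ _ 4] by simp
qed

end
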